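(* Let $(K,|\cdot|)$ be a trivially valued field that is not locally finite. Let $n\ge 2$ and let $\|\cdot\|$ be a non-Archimedean norm on $K^n$. Let $G$ be the group of all affine isometries of $(K^n,\|\cdot\|)$. If the norm $\|\cdot\|$ takes fewer than $n$ distinct nonzero values, then $K^n$ is $G$-paradoxical using four pieces; otherwise $K^n$ is not $G$-paradoxical (using any number of pieces).
   Context: A field $K$ is trivially valued if it is equipped with the valuation $|0|=0$, $|x|=1$ for $x\neq0$. A field is locally finite if each of its finitely generated subfields is finite. A non-Archimedean norm on a linear space $X$ over $(K,|\cdot|)$ is a function $\|\cdot\|\colon X\to[0,\infty)$ with $\|x\|=0\Leftrightarrow x=0$, $\|\alpha x\|=|\alpha|\|x\|$, $\|x+y\|\le\max\{\|x\|,\|y\|\}$. An affine isometry of $(K^n,\|\cdot\|)$ is a map $x\mapsto Lx+\tau$ with $L\in\mathrm{GL}(n,K)$ satisfying $\|Lx\|=\|x\|$ for all $x\in K^n$, and $\tau\in K^n$. Let $G$ be a group acting on a set $X$. A nonempty subset $E\subseteq X$ is $G$-paradoxical using $r$ pieces if for some positive integers $m,l$ with $m+l=r$ there exist pairwise disjoint subsets $A_1,\dots,A_m,B_1,\dots,B_l$ of $E$ and elements $g_1,\dots,g_m,h_1,\dots,h_l\in G$ such that $E=A_1\sqcup\dots\sqcup A_m\sqcup B_1\sqcup\dots\sqcup B_l=\bigsqcup_{i=1}^m g_i(A_i)=\bigsqcup_{j=1}^l h_j(B_j)$, where $\sqcup$ and $\bigsqcup$ denote unions of pairwise disjoint sets.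 $E$ is $G$-paradoxical if it is $G$-paradoxical using $r$ pieces for some $r$. *)

theory Defs
  imports
    "HOL-Analysis.Analysis"
    "HOL-Algebra.Group_Action"
    "HOL-Algebra.Generated_Fields"
    "HOL-Algebra.Algebraic_Closure_Type"
begin

definition trivial_valuation :: "('k::field \<Rightarrow> real) \<Rightarrow> bool" where
  "trivial_valuation v \<longleftrightarrow> v 0 = 0 \<and> (\<forall>x. x \<noteq> 0 \<longrightarrow> v x = 1)"

definition locally_finite_field :: "('a, 'b) ring_scheme \<Rightarrow> bool" where
  "locally_finite_field R \<longleftrightarrow>
     (\<forall>S. S \<subseteq> carrier R \<and> finite S \<longrightarrow> finite (generate_field R S))"

definition nonarch_norm :: "('k::field \<Rightarrow> real) \<Rightarrow> ('k ^ 'n \<Rightarrow> real) \<Rightarrow> bool" where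
  "nonarch_norm v N \<longleftrightarrow>
     (\<forall>x. 0 \<le> N x) \<and>
     (\<forall>x. N x = 0 \<longleftrightarrow> x = 0) \<and>
     (\<forall>a x. N (a *s x) = v a * N x) \<and>
     (\<forall>x y. N (x + y) \<le> max (N x) (N y))"

definition affine_isometry :: "('k::field ^ 'n \<Rightarrow> real) \<Rightarrow> ('k ^ 'n \<Rightarrow> 'k ^ 'n) \<Rightarrow> bool" where
  "affine_isometry N f \<longleftrightarrow>
     (\<exists>(L :: 'k ^ 'n ^ 'n) \<tau>. invertible L \<and> (\<forall>x. N (L *v x) = N x) \<and> f = (\<lambda>x. L *v x + \<tau>))"

definition affine_isometry_group :: "('k::field ^ 'n \<Rightarrow> real) \<Rightarrow> ('k ^ 'n \<Rightarrow> 'k ^ 'n) monoid" where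
  "affine_isometry_group N =
     \<lparr>carrier = {f. affine_isometry N f}, monoid.mult = (\<circ>), one = id\<rparr>"

text \<open>
  \<open>G\<close> acts on \<open>S\<close> through \<open>\<phi>\<close> (as in the locale \<^locale>\<open>group_action\<close>). The \<open>m\<close> pieces \<open>A i\<close> and the \<open>l\<close>
  pieces \<open>B j\<close> are indexed families, so single pieces may be empty; they are
  subsets of \<open>E\<close> because they cover exactly \<open>E\<close>.
\<close>
definition paradoxical_using ::
    "('g, 'b) monoid_scheme \<Rightarrow> 'x set \<Rightarrow> ('g \<Rightarrow> 'x \<Rightarrow> 'x) \<Rightarrow> 'x set \<Rightarrow> nat \<Rightarrow> bool" where
  "paradoxical_using G S \<phi> E r \<longleftrightarrow>
     E \<subseteq> S \<and> E \<noteq> {} \<and>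
     (\<exists>m l (A :: nat \<Rightarrow> 'x set) (B :: nat \<Rightarrow> 'x set) g h.
        0 < m \<and> 0 < l \<and> m + l = r \<and>
        (\<forall>i<m. g i \<in> carrier G) \<and> (\<forall>j<l. h j \<in> carrier G) \<and>
        disjoint_family_on A {..<m} \<and> disjoint_family_on B {..<l} \<and>
        (\<forall>i<m. \<forall>j<l. A i \<inter> B j = {}) \<and>
        E = (\<Union>i<m. A i) \<union> (\<Union>j<l. B j) \<and>
        disjoint_family_on (\<lambda>i. \<phi> (g i) ` A i) {..<m} \<and>
        E = (\<Union>i<m. \<phi> (g i) ` A i) \<and>
        disjoint_family_on (\<lambda>j. \<phi> (h j) ` B j) {..<l} \<and>
        E = (\<Union>j<l. \<phi> (h j) ` B j))"

definition paradoxical ::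
    "('g, 'b) monoid_scheme \<Rightarrow> 'x set \<Rightarrow> ('g \<Rightarrow> 'x \<Rightarrow> 'x) \<Rightarrow> 'x set \<Rightarrow> bool" where
  "paradoxical G S \<phi> E \<longleftrightarrow> (\<exists>r. paradoxical_using G S \<phi> E r)"

lemma affine_isometry_id: "affine_isometry N id"
  unfolding affine_isometry_def
  by (intro exI[of _ "mat 1"] exI[of _ 0]) (auto simp: invertible_def id_def intro: exI[of _ "mat 1"])

lemma affine_isometry_comp:
  assumes "affine_isometry N f" "affine_isometry N g"
  shows "affine_isometry N (f \<circ> g)"
proof -
  obtain L t M s where
    L: "invertible L" "\<And>x. N (L *v x) = N x" "f = (\<lambda>x. L *v x + t)" and
    M: "invertible M" "\<And>x. N (M *v x) = N x" "g = (\<lambda>x. M *v x + s)"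
    using assms unfolding affine_isometry_def by metis
  have "f \<circ> g = (\<lambda>x. (L ** M) *v x + (L *v s + t))"
    by (auto simp: L M matrix_vector_mul_assoc matrix_vector_right_distrib add.assoc)
  moreover have "invertible (L ** M)"
    using L M by (simp add: invertible_mult)
  moreover have "N ((L ** M) *v x) = N x" for x
    using L M by (simp flip: matrix_vector_mul_assoc)
  ultimately show ?thesis
    unfolding affine_isometry_def by blast
qed

lemma affine_isometry_left_inverse:
  assumes "affine_isometry N f"
  shows "\<exists>g. affine_isometry N g \<and> g \<circ> f = id \<and> f \<circ> g = id"
proof -
  obtain L t where
    L: "invertible L" "\<And>x. N (L *v x) = N x" "f = (\<lambda>x. L *v x + t)"
    using assms unfolding affine_isometry_def by metis
  obtain M where M: "L ** M = mat 1" "M ** L = mat 1"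
    using L unfolding invertible_def by metis
  define g where "g = (\<lambda>x. M *v x + - (M *v t))"
  have LM: "L *v (M *v x) = x" "M *v (L *v x) = x" for x
    by (simp_all add: matrix_vector_mul_assoc M)
  have "N (M *v x) = N x" for x
    using L(2)[of "M *v x"] by (simp add: LM)
  moreover have "invertible M"
    using M unfolding invertible_def by blast
  ultimately have "affine_isometry N g"
    unfolding affine_isometry_def g_def by blast
  moreover have "g (f x) = x" for x
    by (simp add: g_def L matrix_vector_right_distrib LM)
  moreover have "f (g x) = x" for x
    by (simp add: g_def L matrix_vector_mult_diff_distrib LM)
  ultimately show ?thesis
    by (auto simp: fun_eq_iff)
qed

lemma group_affine_isometry_group: "group (affine_isometry_group N)"
  by (rule groupI)
     (use affine_isometry_left_inverse in
       \<open>auto simp: affine_isometry_group_def affine_isometry_comp affine_isometry_id o_assoc\<close>)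

lemma group_action_affine_isometry_group:
  "group_action (affine_isometry_group N) UNIV (\<lambda>f. f)"
proof -
  have "bij f" if "affine_isometry N f" for f
    using affine_isometry_left_inverse[OF that] o_bij by blast
  then have "(\<lambda>f. f) \<in> hom (affine_isometry_group N) (BijGroup UNIV)"
    by (auto simp: hom_def affine_isometry_group_def BijGroup_def Bij_def compose_def fun_eq_iff)
  then show ?thesis
    by (simp add: group_action_def group_hom_def group_hom_axioms_def
        group_affine_isometry_group group_BijGroup)
qed

end

theory Submission
  imports Defs
begin

text \<open>
Since \<open>|\<cdot>|\<close> is trivial, the norm is constant on punctured lines, so the balls are linear
subspaces and the norm is a flag of subspaces together with one real value per step; vectors with
distinct nonzero norms are linearly independent. A linear isometry is an automorphism that preserves
the flag. Two cases arise: the number of values is below \<open>n\<close>, and some step of the flag has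
dimension at least two, or there are \<open>n\<close> values, and the flag is complete.

\<^emph>\<open>Complete flag.\<close> The isometries form a triangular, hence solvable, group. Amenability is used in the
following elementary form (\<open>almost_invariant\<close>): for finitely many maps there is a finite list of points
whose uniform distribution is almost invariant. The property passes from \<open>N\<close> to \<open>G\<close> when commutators
of \<open>G\<close> lie in \<open>N\<close> (\<open>almost_invariant_abelian_extension\<close>), so it climbs along a subnormal series with
abelian quotients: isometries that move every point by less than \<open>r\<close>, then those that move points by
at most \<open>r\<close> and act as the identity on differences modulo the open ball, then all that move points by
at most \<open>r\<close>. Integrating the indicator functions of the pieces against such a list contradicts a
paradoxical decomposition (\<open>not_paradoxical_if_almost_invariant\<close>).

\<^emph>\<open>A step of dimension at least two.\<close> There are vectors \<open>e\<close>, \<open>f\<close> of norm at most \<open>r\<close> and dual functionals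
\<open>\<phi>\<close>, \<open>\<psi>\<close> that vanish where the norm is below \<open>r\<close>; every affine automorphism of the \<open>(\<phi>, \<psi>)\<close>-plane
whose linear part is diagonal in a suitable basis is then realised by an isometry
(\<open>affine_isometry_two_plane\<close>). Two such maps \<open>a\<close>, \<open>b\<close> have to be found whose Schreier graph on the
plane can be oriented so that every point selects at most one of its four incident edges and every
edge is selected by exactly one of its ends. The sets of points that select a given letter play
ping-pong, and four-piece paradoxicality follows (\<open>ping_pong_partition\<close>).

As \<open>K\<close> is not locally finite, there is \<open>u\<close> such that \<open>w = u\<^sup>3 - u - 1\<close> is nonzero and \<open>1/w\<close> is not an
integral polynomial in \<open>u\<close>: in characteristic zero \<open>u = 2\<close> and \<open>w = 5\<close>, in positive characteristic a
transcendental \<open>u\<close>. By Chevalley's argument there is a valuation ring \<open>V\<close> that contains \<open>u\<close> and not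
\<open>1/w\<close>. Take \<open>a(p, q) = (p/w, wq)\<close> and let \<open>b\<close> be given by the same formula in the affine
coordinates \<open>(x - y - 1, x - uy - u\<^sup>2)\<close>. Measure points by the larger of \<open>1\<close>, \<open>|x|\<close>, \<open>|y|\<close>. A
neighbour of a point is not larger than the point only if the point lies near one of the four axes of
\<open>a\<close> and \<open>b\<close>. The directions of the axes stay distinct modulo the maximal ideal and no three axes are
concurrent there, because \<open>u\<close>, \<open>u - 1\<close>, \<open>u + 1\<close> are units: their product is \<open>1 + w\<close>. Hence a point
outside \<open>V\<^sup>2\<close> is near at most one axis, a point of \<open>V\<^sup>2\<close> near at most two, and in the latter case both
edges lead to points of \<open>V\<^sup>2\<close> again. What remains to orient is a graph of degree at most two, a disjoint
union of paths and cycles (\<open>orientation_exists\<close>).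
\<close>

section \<open>Four pieces from an orientation of a graph\<close>

text \<open>
  Half-edges \<open>h\<close> are paired by \<open>\<sigma>\<close> into edges, and \<open>H\<close> is the set of half-edges that may be selected.
  Selecting \<open>h\<close> forbids another half-edge \<open>h'\<close> of \<open>H\<close> at the same vertex, which forces \<open>\<sigma> h'\<close> to be
  selected. As a vertex has at most two half-edges in \<open>H\<close>, this forcing relation \<open>R\<close> is a partial injection,
  and the only danger is that \<open>h\<close> forces \<open>\<sigma> h\<close>. That cannot happen: such a chain is symmetric under
  \<open>\<sigma>\<close> and would have to turn round in its middle. So a maximal consistent selection is total.
\<close>
lemma orientation_exists:
  fixes \<sigma> :: "'h \<Rightarrow> 'h" and vtx :: "'h \<Rightarrow> 'v"
  assumes invol: "\<And>h. \<sigma> (\<sigma> h) = h"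
    and no_fix: "\<And>h. \<sigma> h \<noteq> h"
    and cover: "\<And>h. h \<in> H \<or> \<sigma> h \<in> H"
    and two: "\<And>h h' h''. \<lbrakk>h \<in> H; h' \<in> H; h'' \<in> H; vtx h = vtx h'; vtx h = vtx h''\<rbrakk>
                \<Longrightarrow> h = h' \<or> h = h'' \<or> h' = h''"
    and closed: "\<And>h h'. \<lbrakk>h \<in> H; h' \<in> H; vtx h = vtx h'; h \<noteq> h'\<rbrakk> \<Longrightarrow> \<sigma> h' \<in> H"
  obtains C where "C \<subseteq> H" "\<And>h. h \<in> C \<longleftrightarrow> \<sigma> h \<notin> C" "inj_on vtx C"
proof -
  define R where "R h k \<longleftrightarrow> h \<in> H \<and> \<sigma> k \<in> H \<and> vtx h = vtx (\<sigma> k) \<and> h \<noteq> \<sigma> k" for h k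
  have R_sym: "R (\<sigma> k) (\<sigma> h)" if "R h k" for h k
    using that by (auto simp: R_def invol)
  have R_H: "k \<in> H" if "R h k" for h k
    using that closed[of h "\<sigma> k"] by (auto simp: R_def invol)
  have R_unique: "k = k'" if "R h k" "R h k'" for h k k'
    using that two[of h "\<sigma> k" "\<sigma> k'"] invol unfolding R_def by metis
  have Rs_sym: "R\<^sup>*\<^sup>* (\<sigma> k) (\<sigma> h)" if "R\<^sup>*\<^sup>* h k" for h k
    using that by (induction) (auto intro: R_sym converse_rtranclp_into_rtranclp)
  have not_self_step: "\<not> R h (\<sigma> h)" for h
    by (auto simp: R_def invol)
  \<comment> \<open>A chain from \<open>h\<close> to \<open>\<sigma> h\<close> can be shortened at both ends by the symmetry of \<open>R\<close>.\<close>
  have no_return: "\<not> (R ^^ n) h (\<sigma> h)" for n h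
  proof (induction n arbitrary: h rule: less_induct)
    case (less n)
    show ?case
    proof
      assume ret: "(R ^^ n) h (\<sigma> h)"
      consider "n = 0" | "n = 1" | m where "n = Suc (Suc m)"
        by (metis One_nat_def nat.exhaust)
      then show False
      proof cases
        case 1
        then show False using ret no_fix[of h] by simp
      next
        case 2
        then show False using ret[unfolded \<open>n = 1\<close> relpowp_1] not_self_step by blast
      next
        case (3 m)
        then obtain k where k: "R h k" "(R ^^ Suc m) k (\<sigma> h)"
          using ret relpowp_Suc_D2[of "Suc m" R h "\<sigma> h"] by auto
        then obtain l where l: "(R ^^ m) k l" "R l (\<sigma> h)"
          by (auto elim: relpowp_Suc_E)
        have "R h (\<sigma> l)" using R_sym[OF l(2)] by (simp add: invol)
        then have "\<sigma> k = l" using R_unique[OF k(1)] invol by metis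
        then show False using l(1) less.IH[of m k] 3 by simp
      qed
    qed
  qed
  then have Rs_no_return: "\<not> R\<^sup>*\<^sup>* h (\<sigma> h)" for h
    by (auto simp: rtranclp_power)
  define admissible where "admissible = {C. C \<subseteq> H \<and> (\<forall>h\<in>C. \<sigma> h \<notin> C) \<and> (\<forall>h\<in>C. \<forall>k. R h k \<longrightarrow> k \<in> C)}"
  have "\<exists>V\<in>admissible. \<forall>U\<in>K. U \<subseteq> V" if K: "subset.chain admissible K" for K
  proof (intro bexI[of _ "\<Union>K"] ballI)
    have sub: "K \<subseteq> admissible" and tot: "\<And>U W. U \<in> K \<Longrightarrow> W \<in> K \<Longrightarrow> U \<subseteq> W \<or> W \<subseteq> U"
      using K by (auto simp: subset.chain_def)
    have "\<sigma> h \<notin> \<Union>K" if "h \<in> \<Union>K" for h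
    proof
      assume "\<sigma> h \<in> \<Union>K"
      then obtain U W where "U \<in> K" "W \<in> K" "h \<in> U" "\<sigma> h \<in> W" using \<open>h \<in> \<Union>K\<close> by blast
      then obtain Z where "Z \<in> K" "h \<in> Z" "\<sigma> h \<in> Z" using tot by blast
      then show False using sub by (auto simp: admissible_def)
    qed
    moreover have "k \<in> \<Union>K" if "h \<in> \<Union>K" "R h k" for h k
      using that sub unfolding admissible_def by blast
    moreover have "\<Union>K \<subseteq> H" using sub unfolding admissible_def by blast
    ultimately show "\<Union>K \<in> admissible" unfolding admissible_def by blast
  qed auto
  from subset_Zorn[OF this] obtain C where C: "C \<in> admissible"
    and max: "\<And>U. U \<in> admissible \<Longrightarrow> C \<subseteq> U \<Longrightarrow> U = C"
    by meson
  have C_H: "C \<subseteq> H" and C_anti: "\<And>h. h \<in> C \<Longrightarrow> \<sigma> h \<notin> C" and C_R: "\<And>h k. h \<in> C \<Longrightarrow> R h k \<Longrightarrow> k \<in> C"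
    using C by (auto simp: admissible_def)
  have C_Rs: "k \<in> C" if "R\<^sup>*\<^sup>* h k" "h \<in> C" for h k
    using that by induction (auto intro: C_R)
  have full_H: "h \<in> C" if h: "h \<in> H" "\<sigma> h \<notin> C" for h
  proof -
    \<comment> \<open>The forced consequences of \<open>h\<close>, which can be added to \<open>C\<close> by maximality.\<close>
    define D where "D = {k. R\<^sup>*\<^sup>* h k}"
    have "D \<subseteq> H"
    proof
      fix k assume "k \<in> D"
      then have "R\<^sup>*\<^sup>* h k" by (simp add: D_def)
      then show "k \<in> H" by cases (auto simp: h R_H)
    qed
    have DC: "\<sigma> k \<notin> C" if "k \<in> D" for k
      using that C_Rs[OF Rs_sym] h by (auto simp: D_def)
    have DD: "\<sigma> k \<notin> D" if "k \<in> D" for k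
    proof
      assume "\<sigma> k \<in> D"
      then have "R\<^sup>*\<^sup>* k (\<sigma> h)" using Rs_sym[of h "\<sigma> k"] by (simp add: D_def invol)
      then have "R\<^sup>*\<^sup>* h (\<sigma> h)" using that by (auto simp: D_def)
      then show False using Rs_no_return by blast
    qed
    have "C \<union> D \<in> admissible"
    proof -
      have "\<sigma> k \<notin> C \<union> D" if "k \<in> C \<union> D" for k
        using that C_anti DC DD invol by (metis Un_iff)
      moreover have "l \<in> C \<union> D" if "k \<in> C \<union> D" "R k l" for k l
        using that C_R by (auto simp: D_def intro: rtranclp.rtrancl_into_rtrancl)
      ultimately show ?thesis using C_H \<open>D \<subseteq> H\<close> by (auto simp: admissible_def)
    qed
    then have "C \<union> D = C" using max by blast
    moreover have "h \<in> D" by (simp add: D_def)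
    ultimately show "h \<in> C" by blast
  qed
  show thesis
  proof
    show "C \<subseteq> H" by (rule C_H)
    show "h \<in> C \<longleftrightarrow> \<sigma> h \<notin> C" for h
      using C_anti full_H cover[of h] invol by metis
    show "inj_on vtx C"
    proof (rule inj_onI, rule ccontr)
      fix h h' assume "h \<in> C" "h' \<in> C" "vtx h = vtx h'" "h \<noteq> h'"
      then have "R h (\<sigma> h')" using C_H by (auto simp: R_def invol)
      then show False using C_R C_anti \<open>h \<in> C\<close> \<open>h' \<in> C\<close> by blast
    qed
  qed
qed

text \<open>
  The points \<open>D\<close> outside the four ping-pong sets form a fundamental domain. The forward orbit of \<open>D\<close>
  under \<open>a\<close> is absorbed in the second set of \<open>a\<close>, at the cost of removing its image under \<open>a\<close> from the
  first one; this is the trick that turns the four reduced-word sets of a free group, which miss the identity,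
  into a partition.
\<close>
lemma ping_pong_partition:
  fixes a b :: "'x \<Rightarrow> 'x"
  assumes "inj a"
    and A: "A\<^sub>1 = a ` (- A\<^sub>2)" and B: "B\<^sub>1 = b ` (- B\<^sub>2)"
    and disj: "A\<^sub>1 \<inter> A\<^sub>2 = {}" "B\<^sub>1 \<inter> B\<^sub>2 = {}" "(A\<^sub>1 \<union> A\<^sub>2) \<inter> (B\<^sub>1 \<union> B\<^sub>2) = {}"
  obtains A' A'' where "A' = a ` (- A'')" "A' \<inter> A'' = {}" "A' \<union> A'' = - (B\<^sub>1 \<union> B\<^sub>2)"
proof
  define D where "D = - (A\<^sub>1 \<union> A\<^sub>2 \<union> B\<^sub>1 \<union> B\<^sub>2)"
  define E where "E = (\<Union>n. (a ^^ n) ` D)"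
  have aE: "a ` E = (\<Union>n. (a ^^ Suc n) ` D)"
    by (auto simp: E_def image_iff)
  have E_eq: "E = D \<union> a ` E"
  proof (rule equalityI)
    show "E \<subseteq> D \<union> a ` E"
    proof
      fix x assume "x \<in> E"
      then obtain n where "x \<in> (a ^^ n) ` D" by (auto simp: E_def)
      then show "x \<in> D \<union> a ` E"
        unfolding aE by (cases n) auto
    qed
    have "(a ^^ n) ` D \<subseteq> E" for n unfolding E_def by blast
    from this[of 0] this show "D \<union> a ` E \<subseteq> E" unfolding aE by (simp del: funpow.simps(2)) blast
  qed
  have "(a ^^ n) ` D \<inter> A\<^sub>2 = {}" for n
  proof (induction n)
    case 0 then show ?case by (auto simp: D_def)
  next
    case (Suc n)
    have "(a ^^ Suc n) ` D = a ` ((a ^^ n) ` D)" by (simp add: image_comp)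
    also have "\<dots> \<subseteq> A\<^sub>1" using Suc unfolding A by (intro image_mono) blast
    finally show ?case using disj by blast
  qed
  then have E_A2: "E \<inter> A\<^sub>2 = {}" by (auto simp: E_def)
  then have aE_A1: "a ` E \<subseteq> A\<^sub>1" unfolding A by (intro image_mono) blast
  show "A\<^sub>1 - a ` E = a ` (- (A\<^sub>2 \<union> E))"
    unfolding A using \<open>inj a\<close> by (auto simp: inj_def)
  show "(A\<^sub>1 - a ` E) \<inter> (A\<^sub>2 \<union> E) = {}"
    using disj E_eq by (auto simp: D_def)
  show "(A\<^sub>1 - a ` E) \<union> (A\<^sub>2 \<union> E) = - (B\<^sub>1 \<union> B\<^sub>2)"
    using disj E_eq aE_A1 D_def by blast
qed

text \<open>
  A point \<open>x\<close> has the four half-edges \<open>(x, i, e)\<close>; for true \<open>e\<close> the half-edge points to \<open>g i x\<close>, otherwise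
  to \<open>f i x\<close>. The sets \<open>Q i e\<close> say which half-edges \<open>x\<close> may select.
\<close>
lemma paradoxical_using_four_of_half_edges:
  fixes f g :: "bool \<Rightarrow> 'x \<Rightarrow> 'x" and Q :: "bool \<Rightarrow> bool \<Rightarrow> 'x set" and G :: "('x \<Rightarrow> 'x, 'c) monoid_scheme"
  assumes G: "id \<in> carrier G" "\<And>i. f i \<in> carrier G"
    and fg: "\<And>i x. f i (g i x) = x" "\<And>i x. g i (f i x) = x"
    and cover: "\<And>i x. f i x \<in> Q i True \<or> x \<in> Q i False"
    and two: "\<And>x i e j d k c. \<lbrakk>x \<in> Q i e; x \<in> Q j d; x \<in> Q k c\<rbrakk>
                \<Longrightarrow> (i, e) = (j, d) \<or> (i, e) = (k, c) \<or> (j, d) = (k, c)"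
    and level: "\<And>x i e j d. \<lbrakk>x \<in> Q i e; x \<in> Q j d; (i, e) \<noteq> (j, d)\<rbrakk>
                  \<Longrightarrow> (if e then g i x else f i x) \<in> Q i (\<not> e)"
  shows "paradoxical_using G UNIV (\<lambda>h. h) UNIV 4"
proof -
  define \<sigma> :: "'x \<times> bool \<times> bool \<Rightarrow> _" where
    "\<sigma> = (\<lambda>(x, i, e). ((if e then g i x else f i x), i, \<not> e))"
  define H where "H = {(x, i, e). x \<in> Q i e}"
  obtain C where C: "C \<subseteq> H" "\<And>h. h \<in> C \<longleftrightarrow> \<sigma> h \<notin> C" "inj_on fst C"
  proof (rule orientation_exists[of \<sigma> H fst])
    show "\<sigma> (\<sigma> h) = h" for h by (cases h) (auto simp: \<sigma>_def fg)
    show "\<sigma> h \<noteq> h" for h by (cases h) (auto simp: \<sigma>_def)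
    show "h \<in> H \<or> \<sigma> h \<in> H" for h
    proof (cases h)
      case (fields x i e)
      then show ?thesis using cover[of i x] cover[of i "g i x"]
        by (cases e) (auto simp: \<sigma>_def H_def fg)
    qed
    show "\<sigma> h' \<in> H" if "h \<in> H" "h' \<in> H" "fst h = fst h'" "h \<noteq> h'" for h h'
    proof -
      obtain x i e y j d where "h = (x, i, e)" "h' = (y, j, d)" by (metis prod_cases3)
      then show ?thesis using that level[of x j d i e] by (auto simp: \<sigma>_def H_def)
    qed
    show "h = h' \<or> h = h'' \<or> h' = h''"
      if "h \<in> H" "h' \<in> H" "h'' \<in> H" "fst h = fst h'" "fst h = fst h''" for h h' h''
    proof -
      obtain x i e y j d z k c where "h = (x, i, e)" "h' = (y, j, d)" "h'' = (z, k, c)"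
        by (metis prod_cases3)
      then show ?thesis using that two[of x i e j d k c] by (auto simp: H_def)
    qed
  qed (rule that)
  define P where "P i e = {x. (x, i, e) \<in> C}" for i e
  have P_image: "P i True = f i ` (- P i False)" for i
  proof -
    have "x \<in> P i True \<longleftrightarrow> g i x \<notin> P i False" for x
      using C(2)[of "(x, i, True)"] by (simp add: P_def \<sigma>_def)
    note this[simp]
    show ?thesis
    proof (intro equalityI subsetI)
      fix x assume "x \<in> P i True"
      then have "g i x \<in> - P i False" by simp
      then show "x \<in> f i ` (- P i False)" using fg(1)[of i x] by (metis imageI)
    next
      fix x assume "x \<in> f i ` (- P i False)"
      then show "x \<in> P i True" by (auto simp: fg)
    qed
  qed
  have P_disj: "P i e \<inter> P j d = {}" if "(i, e) \<noteq> (j, d)" for i e j d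
  proof -
    have "(x, i, e) \<notin> C \<or> (x, j, d) \<notin> C" for x
      using inj_onD[OF C(3), of "(x, i, e)" "(x, j, d)"] that by auto
    then show ?thesis by (auto simp: P_def)
  qed
  have inj: "inj (f i)" for i by (metis injI fg(2))
  obtain A' A'' where A: "A' = f True ` (- A'')" "A' \<inter> A'' = {}"
      "A' \<union> A'' = - (P False True \<union> P False False)"
    by (rule ping_pong_partition[OF inj P_image P_image, of True False])
       (use P_disj in \<open>auto simp: Int_Un_distrib Int_Un_distrib2\<close>)
  let ?A = "\<lambda>n::nat. if n = 0 then A' else A''"
  let ?B = "\<lambda>n::nat. if n = 0 then P False True else P False False"
  let ?g = "\<lambda>i. \<lambda>n::nat. if n = 0 then id else f i"
  have two_set: "{..<2::nat} = {0, 1}" by auto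
  have fA: "f True ` A'' = - A'"
    using A(1) inj[of True] fg by (metis bij_image_Compl_eq double_compl o_bij comp_apply eq_id_iff)
  have fB: "f False ` P False False = - P False True"
    using P_image[of False] fg by (metis bij_image_Compl_eq double_compl o_bij comp_apply eq_id_iff)
  have all_two: "(\<forall>n<2. P n) \<longleftrightarrow> P 0 \<and> P (1::nat)" for P
    by (auto simp: less_2_cases_iff)
  have cover_all: "(\<Union>i<2. ?A i) \<union> (\<Union>j<2. ?B j) = UNIV"
    using A(3) by (auto simp: two_set)
  have cover_A: "(\<Union>i<2. ?g True i ` ?A i) = UNIV" and cover_B: "(\<Union>i<2. ?g False i ` ?B i) = UNIV"
    by (auto simp: two_set fA fB)
  have AB: "A' \<inter> P False e = {}" "A'' \<inter> P False e = {}" for e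
    using A(3) by (cases e, auto)+
  have PP: "P False True \<inter> P False False = {}" by (rule P_disj) simp
  have "\<exists>m l A B g h. 0 < m \<and> 0 < l \<and> m + l = (4::nat) \<and>
        (\<forall>i<m. g i \<in> carrier G) \<and> (\<forall>j<l. h j \<in> carrier G) \<and>
        disjoint_family_on A {..<m} \<and> disjoint_family_on B {..<l} \<and>
        (\<forall>i<m. \<forall>j<l. A i \<inter> B j = {}) \<and>
        UNIV = (\<Union>i<m. A i) \<union> (\<Union>j<l. B j) \<and>
        disjoint_family_on (\<lambda>i. g i ` A i) {..<m} \<and> UNIV = (\<Union>i<m. g i ` A i) \<and>
        disjoint_family_on (\<lambda>j. h j ` B j) {..<l} \<and> UNIV = (\<Union>j<l. h j ` B j)"
    apply (rule exI[of _ 2], rule exI[of _ 2], rule exI[of _ ?A], rule exI[of _ ?B],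
        rule exI[of _ "?g True"], rule exI[of _ "?g False"])
    unfolding cover_all cover_A cover_B all_two
    using A(2) AB PP by (simp add: G disjoint_family_on_def two_set fA fB Int_commute)
  then show ?thesis
    unfolding paradoxical_using_def by simp
qed

section \<open>Almost invariant finite distributions\<close>

text \<open>
  A Foelner condition. The list consists of points of the space rather than of elements of \<open>S\<close>, so that it can
  be pushed forward by arbitrary maps; repetitions serve as weights.
\<close>
definition almost_invariant :: "('x \<Rightarrow> 'x) set \<Rightarrow> bool" where
  "almost_invariant S \<longleftrightarrow>
    (\<forall>F \<epsilon>. finite F \<longrightarrow> F \<subseteq> S \<longrightarrow> 0 < \<epsilon> \<longrightarrow>
      (\<exists>ps. ps \<noteq> [] \<and> (\<forall>f\<in>F. \<forall>h :: 'x \<Rightarrow> real. (\<forall>x. \<bar>h x\<bar> \<le> 1) \<longrightarrow>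
        \<bar>\<Sum>p\<leftarrow>ps. h (f p) - h p\<bar> \<le> \<epsilon> * real (length ps))))"

lemma almost_invariant_singleton_id: "almost_invariant {id :: 'x \<Rightarrow> 'x}"
  unfolding almost_invariant_def
proof (intro allI impI)
  fix F :: "('x \<Rightarrow> 'x) set" and \<epsilon> :: real assume "F \<subseteq> {id}" "0 < \<epsilon>"
  then show "\<exists>ps. ps \<noteq> [] \<and> (\<forall>f\<in>F. \<forall>h :: 'x \<Rightarrow> real. (\<forall>x. \<bar>h x\<bar> \<le> 1) \<longrightarrow>
        \<bar>\<Sum>p\<leftarrow>ps. h (f p) - h p\<bar> \<le> \<epsilon> * real (length ps))"
    by (intro exI[of _ "[undefined]"]) auto
qed

lemma almost_invariant_if_finite_subsets:
  assumes "\<And>F. finite F \<Longrightarrow> F \<subseteq> S \<Longrightarrow> \<exists>T. F \<subseteq> T \<and> almost_invariant T"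
  shows "almost_invariant S"
  unfolding almost_invariant_def
proof (intro allI impI)
  fix F :: "('a \<Rightarrow> 'a) set" and \<epsilon> :: real assume F: "finite F" "F \<subseteq> S" "0 < \<epsilon>"
  obtain T where "F \<subseteq> T" "almost_invariant T" using assms[OF F(1,2)] by blast
  then show "\<exists>ps. ps \<noteq> [] \<and> (\<forall>f\<in>F. \<forall>h :: 'a \<Rightarrow> real. (\<forall>x. \<bar>h x\<bar> \<le> 1) \<longrightarrow>
        \<bar>\<Sum>p\<leftarrow>ps. h (f p) - h p\<bar> \<le> \<epsilon> * real (length ps))"
    using F unfolding almost_invariant_def by blast
qed

lemma almost_invariant_mono: "almost_invariant T \<Longrightarrow> S \<subseteq> T \<Longrightarrow> almost_invariant S"
  by (rule almost_invariant_if_finite_subsets) (use subset_trans in auto)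

text \<open>
  An error \<open>\<epsilon>/2\<close> for each factor adds up to \<open>\<epsilon>\<close>, because a test function composed with \<open>g\<close> is again a test
  function.
\<close>
lemma almost_invariant_comp:
  assumes "almost_invariant S" "\<And>f. f \<in> T \<Longrightarrow> \<exists>g k. f = g \<circ> k \<and> g \<in> S \<and> k \<in> S"
  shows "almost_invariant T"
  unfolding almost_invariant_def
proof (intro allI impI)
  fix F and \<epsilon> :: real assume F: "finite F" "F \<subseteq> T" and "0 < \<epsilon>"
  obtain g k where gk: "\<And>f. f \<in> F \<Longrightarrow> f = g f \<circ> k f \<and> g f \<in> S \<and> k f \<in> S"
    using assms(2) F(2) by (metis subsetD)
  have "finite (g ` F \<union> k ` F)" "g ` F \<union> k ` F \<subseteq> S" "0 < \<epsilon> / 2"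
    using F gk \<open>0 < \<epsilon>\<close> by auto
  then obtain ps where ps: "ps \<noteq> []"
    and inv: "\<And>f h. f \<in> g ` F \<union> k ` F \<Longrightarrow> (\<forall>x. \<bar>h x\<bar> \<le> 1) \<Longrightarrow>
        \<bar>\<Sum>p\<leftarrow>ps. h (f p) - h p\<bar> \<le> \<epsilon> / 2 * real (length ps)"
    using assms(1) unfolding almost_invariant_def by meson
  show "\<exists>ps. ps \<noteq> [] \<and> (\<forall>f\<in>F. \<forall>h :: 'a \<Rightarrow> real. (\<forall>x. \<bar>h x\<bar> \<le> 1) \<longrightarrow>
        \<bar>\<Sum>p\<leftarrow>ps. h (f p) - h p\<bar> \<le> \<epsilon> * real (length ps))"
  proof (intro exI conjI ballI allI impI)
    show "ps \<noteq> []" by (rule ps)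
    fix f and h :: "'a \<Rightarrow> real" assume f: "f \<in> F" and h: "\<forall>x. \<bar>h x\<bar> \<le> 1"
    have 1: "\<bar>\<Sum>p\<leftarrow>ps. h (g f (k f p)) - h (g f p)\<bar> \<le> \<epsilon> / 2 * real (length ps)"
      using inv[of "k f" "\<lambda>x. h (g f x)"] f h by auto
    have 2: "\<bar>\<Sum>p\<leftarrow>ps. h (g f p) - h p\<bar> \<le> \<epsilon> / 2 * real (length ps)"
      using inv[of "g f" h] f h by auto
    have "f p = g f (k f p)" for p using gk[OF f] by (metis comp_apply)
    then have "(\<Sum>p\<leftarrow>ps. h (f p) - h p) =
        (\<Sum>p\<leftarrow>ps. h (g f (k f p)) - h (g f p)) + (\<Sum>p\<leftarrow>ps. h (g f p) - h p)"
      by (simp flip: sum_list_addf)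
    then show "\<bar>\<Sum>p\<leftarrow>ps. h (f p) - h p\<bar> \<le> \<epsilon> * real (length ps)"
      using 1 2 by linarith
  qed
qed

lemma funpow_normalises:
  assumes "\<And>n. n \<in> S \<Longrightarrow> \<exists>n'\<in>S. n \<circ> s = s \<circ> n'" "n \<in> S"
  shows "\<exists>n'\<in>S. n \<circ> s ^^ i = s ^^ i \<circ> n'"
proof (induction i)
  case 0 then show ?case using assms(2) by auto
next
  case (Suc i)
  then obtain n' n'' where "n' \<in> S" "n \<circ> s ^^ i = s ^^ i \<circ> n'" "n'' \<in> S" "n' \<circ> s = s \<circ> n''"
    using assms(1) by blast
  then have "n \<circ> s ^^ Suc i = s ^^ Suc i \<circ> n''"
    by (metis funpow_Suc_right comp_assoc)
  then show ?case using \<open>n'' \<in> S\<close> by blast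
qed

text \<open>
  A list that is almost invariant under \<open>S\<close> is spread out by the powers \<open>s\<^sup>0, \<dots>, s\<^sup>K\<^sup>-\<^sup>1\<close>. Under \<open>s\<close> the sum
  telescopes and only two of the \<open>K\<close> blocks differ; an element of \<open>S\<close> passes through a power of \<open>s\<close> and
  becomes another element of \<open>S\<close>.
\<close>
lemma almost_invariant_insert:
  assumes "almost_invariant S" and normalises: "\<And>n. n \<in> S \<Longrightarrow> \<exists>n'\<in>S. n \<circ> s = s \<circ> n'"
  shows "almost_invariant (insert s S)"
  unfolding almost_invariant_def
proof (intro allI impI)
  fix F and \<epsilon> :: real assume F: "finite F" "F \<subseteq> insert s S" and \<epsilon>: "0 < \<epsilon>"
  have push: "\<exists>n'\<in>S. n \<circ> s ^^ i = s ^^ i \<circ> n'" if "n \<in> S" for n i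
    by (rule funpow_normalises[OF normalises that])
  then obtain c where c: "\<And>n i. n \<in> S \<Longrightarrow> c n i \<in> S \<and> n \<circ> s ^^ i = s ^^ i \<circ> c n i"
    by metis
  obtain K :: nat where K: "2 / \<epsilon> < real K" using reals_Archimedean2 by blast
  then have K0: "0 < K" and K2: "2 \<le> \<epsilon> * real K" using \<epsilon>
    by (auto simp: field_simps intro!: Nat.gr0I)
  let ?F = "(\<lambda>(n, i). c n i) ` ((F \<inter> S) \<times> {..<K})"
  have "finite ?F" "?F \<subseteq> S" using F c by auto
  then obtain ps where ps: "ps \<noteq> []"
    and inv: "\<And>f h. f \<in> ?F \<Longrightarrow> (\<forall>x. \<bar>h x\<bar> \<le> 1) \<Longrightarrow>
        \<bar>\<Sum>p\<leftarrow>ps. h (f p) - h p\<bar> \<le> \<epsilon> * real (length ps)"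
    using assms(1) \<epsilon> unfolding almost_invariant_def by metis
  define qs where "qs = concat (map (\<lambda>i. map (s ^^ i) ps) [0..<K])"
  have "(\<Sum>q\<leftarrow>concat (map (\<lambda>i. map (s ^^ i) ps) [0..<k]). w q) = (\<Sum>i<k. \<Sum>p\<leftarrow>ps. w ((s ^^ i) p))"
    for w :: "'a \<Rightarrow> real" and k
    by (induction k) (simp_all add: o_def)
  then have sum_qs: "(\<Sum>q\<leftarrow>qs. w q) = (\<Sum>i<K. \<Sum>p\<leftarrow>ps. w ((s ^^ i) p))" for w :: "'a \<Rightarrow> real"
    by (simp add: qs_def)
  have len: "real (length qs) = real K * real (length ps)"
    by (simp add: qs_def length_concat o_def sum_list_triv)
  show "\<exists>ps. ps \<noteq> [] \<and> (\<forall>f\<in>F. \<forall>h :: 'a \<Rightarrow> real. (\<forall>x. \<bar>h x\<bar> \<le> 1) \<longrightarrow>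
        \<bar>\<Sum>p\<leftarrow>ps. h (f p) - h p\<bar> \<le> \<epsilon> * real (length ps))"
  proof (intro exI[of _ qs] conjI ballI allI impI)
    show "qs \<noteq> []" using len ps K0 by auto
    fix f and h :: "'a \<Rightarrow> real" assume f: "f \<in> F" and h: "\<forall>x. \<bar>h x\<bar> \<le> 1"
    show "\<bar>\<Sum>p\<leftarrow>qs. h (f p) - h p\<bar> \<le> \<epsilon> * real (length qs)"
    proof (cases "f \<in> S")
      case True
      have "\<bar>\<Sum>p\<leftarrow>ps. h (f ((s ^^ i) p)) - h ((s ^^ i) p)\<bar> \<le> \<epsilon> * real (length ps)" if "i < K" for i
      proof -
        have "f ((s ^^ i) p) = (s ^^ i) (c f i p)" for p
          using c[OF True, of i] by (metis comp_apply)
        then show ?thesis using inv[of "c f i" "\<lambda>x. h ((s ^^ i) x)"] True f that h by force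
      qed
      then have "(\<Sum>i<K. \<bar>\<Sum>p\<leftarrow>ps. h (f ((s ^^ i) p)) - h ((s ^^ i) p)\<bar>)
          \<le> (\<Sum>i<K. \<epsilon> * real (length ps))"
        by (intro sum_mono) auto
      from order_trans[OF sum_abs this] show ?thesis
        unfolding sum_qs len by (simp add: mult.left_commute)
    next
      case False
      then have "f = s" using f F by auto
      define w where "w i = (\<Sum>p\<leftarrow>ps. h ((s ^^ i) p))" for i
      have w: "\<bar>w i\<bar> \<le> real (length ps)" for i
      proof -
        have "\<bar>w i\<bar> \<le> (\<Sum>p\<leftarrow>ps. \<bar>h ((s ^^ i) p)\<bar>)"
          using sum_list_abs[of "map (\<lambda>p. h ((s ^^ i) p)) ps"] by (simp add: w_def o_def)
        also have "\<dots> \<le> (\<Sum>p\<leftarrow>ps. 1)" by (intro sum_list_mono) (use h in auto)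
        finally show ?thesis by (simp add: sum_list_triv)
      qed
      have "(\<Sum>p\<leftarrow>qs. h (f p) - h p) = (\<Sum>i<K. w (Suc i) - w i)"
        unfolding sum_qs \<open>f = s\<close> w_def by (simp add: sum_list_subtractf)
      also have "\<dots> = w K - w 0" by (rule sum_lessThan_telescope)
      finally have "\<bar>\<Sum>p\<leftarrow>qs. h (f p) - h p\<bar> \<le> 2 * real (length ps)"
        using w[of K] w[of 0] by linarith
      also have "\<dots> \<le> \<epsilon> * real K * real (length ps)" using K2 by (intro mult_right_mono) auto
      finally show ?thesis by (simp add: len mult.assoc)
    qed
  qed
qed

text \<open>
  Finitely many elements of \<open>G\<close> are adjoined to \<open>N\<close> one at a time. Each intermediate monoid \<open>M\<close> contains the
  commutators, so \<open>n \<circ> s = s \<circ> (n \<circ> c)\<close> with \<open>n \<circ> c\<close> in \<open>M\<close>, and the previous lemmas apply.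
\<close>
lemma almost_invariant_abelian_extension:
  assumes N: "almost_invariant N" "N \<subseteq> G" "id \<in> N"
    and N_comp: "\<And>f g. f \<in> N \<Longrightarrow> g \<in> N \<Longrightarrow> f \<circ> g \<in> N"
    and G_comp: "\<And>f g. f \<in> G \<Longrightarrow> g \<in> G \<Longrightarrow> f \<circ> g \<in> G"
    and comm: "\<And>f g. f \<in> G \<Longrightarrow> g \<in> G \<Longrightarrow> \<exists>c\<in>N. f \<circ> g = g \<circ> f \<circ> c"
  shows "almost_invariant G"
proof -
  have "\<exists>M. F \<subseteq> M \<and> N \<subseteq> M \<and> M \<subseteq> G \<and> (\<forall>f\<in>M. \<forall>g\<in>M. f \<circ> g \<in> M) \<and> almost_invariant M"
    if "finite F" "F \<subseteq> G" for F
    using that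
  proof (induction F rule: finite_induct)
    case empty
    show ?case by (rule exI[of _ N]) (simp add: N N_comp del: o_apply)
  next
    case (insert s F)
    then obtain M where M: "F \<subseteq> M" "N \<subseteq> M" "M \<subseteq> G" "almost_invariant M"
      and M_comp: "\<And>f g. f \<in> M \<Longrightarrow> g \<in> M \<Longrightarrow> f \<circ> g \<in> M" by blast
    have s: "s \<in> G" using insert by blast
    have id: "id \<in> M" using N M by blast
    have normalises: "\<exists>n'\<in>M. n \<circ> s = s \<circ> n'" if n: "n \<in> M" for n
    proof -
      obtain c where "c \<in> N" "n \<circ> s = s \<circ> n \<circ> c" using comm n s M by blast
      then show ?thesis using M_comp[of n c] n M by (metis comp_assoc subsetD)
    qed
    have pow_normalises: "\<exists>n'\<in>M. n \<circ> s ^^ i = s ^^ i \<circ> n'" if "n \<in> M" for n i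
      by (rule funpow_normalises[OF normalises that])
    have idG: "id \<in> G" using N by blast
    have pow_G: "s ^^ i \<in> G" for i
    proof (induction i)
      case 0 show ?case using idG by (simp add: id_def)
    next
      case (Suc i) then show ?case using G_comp[OF s Suc] by (simp only: funpow.simps)
    qed
    \<comment> \<open>Bounded powers of \<open>s\<close> suffice for a finite set of maps; \<open>T 0\<close> has exponents \<open>0\<close> and \<open>1\<close>, so that
      \<open>s\<close> is available for the induction step.\<close>
    define T where "T k = {s ^^ i \<circ> m |i m. i \<le> Suc k \<and> m \<in> M}" for k
    have "almost_invariant (T k)" for k
    proof (induction k)
      case 0
      have "almost_invariant (insert s M)"
        by (rule almost_invariant_insert[OF M(4) normalises])
      then show ?case
      proof (rule almost_invariant_comp)
        fix f assume "f \<in> T 0"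
        then obtain i m where f: "f = s ^^ i \<circ> m" "i = 0 \<or> i = 1" "m \<in> M"
          by (auto simp: T_def le_Suc_eq)
        then show "\<exists>g k. f = g \<circ> k \<and> g \<in> insert s M \<and> k \<in> insert s M"
          using id by (intro exI[of _ "s ^^ i"] exI[of _ m]) (auto simp: id_def)
      qed
    next
      case (Suc k)
      then show ?case
      proof (rule almost_invariant_comp)
        fix f assume "f \<in> T (Suc k)"
        then obtain i m where f: "f = s ^^ i \<circ> m" "i \<le> Suc (Suc k)" "m \<in> M"
          by (auto simp: T_def)
        have s_T: "s \<in> T k" unfolding T_def
          by (rule CollectI, rule exI[of _ 1], rule exI[of _ id]) (use id in auto)
        have id_T: "id \<in> T k" unfolding T_def
          by (rule CollectI, rule exI[of _ 0], rule exI[of _ id]) (use id in auto)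
        show "\<exists>g h. f = g \<circ> h \<and> g \<in> T k \<and> h \<in> T k"
        proof (cases i)
          case 0
          then have "f \<in> T k" using f unfolding T_def by blast
          then show ?thesis using id_T by (intro exI[of _ id] exI[of _ f]) auto
        next
          case (Suc j)
          then have "s ^^ j \<circ> m \<in> T k" using f unfolding T_def by auto
          moreover have "f = s \<circ> (s ^^ j \<circ> m)" using f Suc by (simp add: comp_assoc)
          ultimately show ?thesis using s_T by blast
        qed
      qed
    qed
    note T = this
    let ?M = "\<Union>k. T k"
    have T_mono: "T k \<subseteq> T l" if "k \<le> l" for k l
    proof
      fix f assume "f \<in> T k"
      then obtain i m where "f = s ^^ i \<circ> m" "i \<le> Suc k" "m \<in> M" by (auto simp: T_def)
      moreover have "i \<le> Suc l" using calculation that by simp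
      ultimately show "f \<in> T l" unfolding T_def by blast
    qed
    have M_iff: "f \<in> ?M \<longleftrightarrow> (\<exists>i. \<exists>m\<in>M. f = s ^^ i \<circ> m)" for f
      unfolding T_def by (auto intro: le_SucI)
    have "almost_invariant ?M"
    proof (rule almost_invariant_if_finite_subsets)
      fix F assume "finite F" "F \<subseteq> ?M"
      then have "\<exists>k. F \<subseteq> T k"
      proof (induction F rule: finite_induct)
        case (insert f F)
        then obtain k l where "F \<subseteq> T k" "f \<in> T l" by auto
        then have "insert f F \<subseteq> T (max k l)"
          using T_mono[of k "max k l"] T_mono[of l "max k l"] by auto
        then show ?case by blast
      qed auto
      then show "\<exists>T. F \<subseteq> T \<and> almost_invariant T" using T by blast
    qed
    moreover have N_M: "M \<subseteq> ?M"
    proof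
      fix m assume "m \<in> M"
      then show "m \<in> ?M" unfolding M_iff by (intro exI[of _ 0]) auto
    qed
    moreover have "s \<in> ?M" unfolding M_iff
      by (rule exI[of _ 1], rule bexI[of _ id]) (use id in auto)
    moreover have "?M \<subseteq> G"
    proof
      fix f assume "f \<in> ?M"
      then obtain i m where "f = s ^^ i \<circ> m" "m \<in> M" unfolding M_iff by blast
      then show "f \<in> G" using G_comp pow_G M by blast
    qed
    moreover have "f \<circ> g \<in> ?M" if f: "f \<in> ?M" and g: "g \<in> ?M" for f g
    proof -
      obtain i m j n where "f = s ^^ i \<circ> m" "m \<in> M" "g = s ^^ j \<circ> n" "n \<in> M"
        using f g unfolding M_iff by blast
      moreover obtain m' where "m' \<in> M" "m \<circ> s ^^ j = s ^^ j \<circ> m'"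
        using pow_normalises \<open>m \<in> M\<close> by blast
      ultimately have "f \<circ> g = s ^^ (i + j) \<circ> (m' \<circ> n)" "m' \<circ> n \<in> M"
        using M_comp by (auto simp: funpow_add fun_eq_iff)
      then show ?thesis unfolding M_iff by blast
    qed
    moreover have "insert s F \<subseteq> ?M" "N \<subseteq> ?M"
      using M N_M \<open>s \<in> ?M\<close> by blast+
    ultimately show ?case by (intro exI[of _ ?M]) blast
  qed
  note generated = this
  show ?thesis
  proof (rule almost_invariant_if_finite_subsets)
    fix F assume "finite F" "F \<subseteq> G"
    from generated[OF this] show "\<exists>T. F \<subseteq> T \<and> almost_invariant T" by blast
  qed
qed

lemma sum_list_sum_swap:
  fixes f :: "'i \<Rightarrow> 'a \<Rightarrow> real"
  shows "(\<Sum>i\<in>I. \<Sum>p\<leftarrow>ps. f i p) = (\<Sum>p\<leftarrow>ps. \<Sum>i\<in>I. f i p)"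
  by (induction ps) (auto simp: sum.distrib)

text \<open>
  At every point the indicator functions of the translated pieces sum to \<open>2\<close> and those of the pieces
  to \<open>1\<close>. Averaged over an almost invariant list, the two sums must nearly agree.
\<close>
lemma not_paradoxical_if_almost_invariant:
  fixes G :: "('x \<Rightarrow> 'x, 'c) monoid_scheme"
  assumes inv: "almost_invariant (carrier G)"
    and left_inv: "\<And>g. g \<in> carrier G \<Longrightarrow> \<exists>k\<in>carrier G. k \<circ> g = id \<and> g \<circ> k = id"
  shows "\<not> paradoxical G UNIV (\<lambda>g. g) UNIV"
proof
  assume "paradoxical G UNIV (\<lambda>g. g) UNIV"
  then obtain r where "paradoxical_using G UNIV (\<lambda>g. g) UNIV r" unfolding paradoxical_def by blast
  from this[unfolded paradoxical_using_def, THEN conjunct2, THEN conjunct2]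
  obtain m l A B g h where par: "0 < m \<and> 0 < l \<and> m + l = r \<and>
        (\<forall>i<m. g i \<in> carrier G) \<and> (\<forall>j<l. h j \<in> carrier G) \<and>
        disjoint_family_on A {..<m} \<and> disjoint_family_on B {..<l} \<and>
        (\<forall>i<m. \<forall>j<l. A i \<inter> B j = {}) \<and>
        UNIV = (\<Union>i<m. A i) \<union> (\<Union>j<l. B j) \<and>
        disjoint_family_on (\<lambda>i. g i ` A i) {..<m} \<and> UNIV = (\<Union>i<m. g i ` A i) \<and>
        disjoint_family_on (\<lambda>j. h j ` B j) {..<l} \<and> UNIV = (\<Union>j<l. h j ` B j)"
    by (elim exE) (erule that)
  have "0 < m" "0 < l"
    and g: "\<forall>i<m. g i \<in> carrier G" and h: "\<forall>j<l. h j \<in> carrier G"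
    and disj: "disjoint_family_on A {..<m}" "disjoint_family_on B {..<l}" "\<forall>i<m. \<forall>j<l. A i \<inter> B j = {}"
    and cover: "UNIV = (\<Union>i<m. A i) \<union> (\<Union>j<l. B j)"
    and gA: "disjoint_family_on (\<lambda>i. g i ` A i) {..<m}" "UNIV = (\<Union>i<m. g i ` A i)"
    and hB: "disjoint_family_on (\<lambda>j. h j ` B j) {..<l}" "UNIV = (\<Union>j<l. h j ` B j)"
    using par by - (elim conjE, assumption)+
  define inverse_of where "inverse_of f = (SOME k. k \<in> carrier G \<and> k \<circ> f = id \<and> f \<circ> k = id)" for f
  have inverse_of: "inverse_of f \<in> carrier G \<and> inverse_of f \<circ> f = id \<and> f \<circ> inverse_of f = id"
    if "f \<in> carrier G" for f
  proof -
    have "\<exists>k. k \<in> carrier G \<and> k \<circ> f = id \<and> f \<circ> k = id" using left_inv[OF that] by blast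
    from someI_ex[OF this] show ?thesis unfolding inverse_of_def .
  qed
  define gi hi where "gi i = inverse_of (g i)" and "hi i = inverse_of (h i)" for i
  have gi: "gi i \<in> carrier G \<and> gi i \<circ> g i = id \<and> g i \<circ> gi i = id" if "i < m" for i
    unfolding gi_def by (rule inverse_of) (use g that in blast)
  have hi: "hi j \<in> carrier G \<and> hi j \<circ> h j = id \<and> h j \<circ> hi j = id" if "j < l" for j
    unfolding hi_def by (rule inverse_of) (use h that in blast)
  \<comment> \<open>Then the \<open>m + l\<close> errors add up to at most half of the length of the list.\<close>
  define \<epsilon> :: real where "\<epsilon> = 1 / (2 * real (m + l))"
  have \<epsilon>: "0 < \<epsilon>" "real (m + l) * \<epsilon> = 1 / 2" using \<open>0 < m\<close> by (auto simp: \<epsilon>_def)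
  have "finite (gi ` {..<m} \<union> hi ` {..<l})" "gi ` {..<m} \<union> hi ` {..<l} \<subseteq> carrier G"
    using gi hi by auto
  then obtain ps where ps: "ps \<noteq> []"
    and small: "\<And>f h. f \<in> gi ` {..<m} \<union> hi ` {..<l} \<Longrightarrow> (\<forall>x. \<bar>h x\<bar> \<le> 1) \<Longrightarrow>
        \<bar>\<Sum>p\<leftarrow>ps. h (f p) - h p\<bar> \<le> \<epsilon> * real (length ps)"
    using inv \<epsilon>(1) unfolding almost_invariant_def by meson
  have pull: "indicator E (k p) = (indicator (f ` E) p :: real)"
    if "k \<circ> f = id \<and> f \<circ> k = id" for E and k f :: "'x \<Rightarrow> 'x" and p
  proof -
    have "k (f q) = q" "f (k q) = q" for q using that by (auto simp: fun_eq_iff)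
    then have "k p \<in> E \<longleftrightarrow> p \<in> f ` E" by (metis imageE imageI)
    then show ?thesis by (simp add: indicator_def)
  qed
  define S where "S i = (\<Sum>p\<leftarrow>ps. indicator (A i) (gi i p) - indicator (A i) p :: real)" for i
  define T where "T j = (\<Sum>p\<leftarrow>ps. indicator (B j) (hi j p) - indicator (B j) p :: real)" for j
  have "(\<Sum>i<m. indicator (A i) (gi i p) - indicator (A i) p) +
      (\<Sum>j<l. indicator (B j) (hi j p) - indicator (B j) p) = (1::real)" for p
  proof -
    have "(\<Sum>i<m. indicator (A i) (gi i p)) = (\<Sum>i<m. indicator (g i ` A i) p :: real)"
      by (rule sum.cong) (use pull gi in auto)
    also have "\<dots> = 1"
      using indicator_UN_disjoint[OF _ gA(1), of p, where ?'c = real] gA(2) by simp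
    finally have 1: "(\<Sum>i<m. indicator (A i) (gi i p)) = (1::real)" .
    have "(\<Sum>j<l. indicator (B j) (hi j p)) = (\<Sum>j<l. indicator (h j ` B j) p :: real)"
      by (rule sum.cong) (use pull hi in auto)
    also have "\<dots> = 1"
      using indicator_UN_disjoint[OF _ hB(1), of p, where ?'c = real] hB(2) by simp
    finally have 2: "(\<Sum>j<l. indicator (B j) (hi j p)) = (1::real)" .
    have "(\<Union>i<m. A i) \<inter> (\<Union>j<l. B j) = {}" using disj(3) by blast
    then have "indicator (\<Union>i<m. A i) p + indicator (\<Union>j<l. B j) p
        = (indicator ((\<Union>i<m. A i) \<union> (\<Union>j<l. B j)) p :: real)"
      by (auto simp: indicator_def)
    also have "\<dots> = 1" unfolding cover[symmetric] by simp
    finally have 3: "(\<Sum>i<m. indicator (A i) p) + (\<Sum>j<l. indicator (B j) p) = (1::real)"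
      using indicator_UN_disjoint[OF _ disj(1), of p, where ?'c = real]
        indicator_UN_disjoint[OF _ disj(2), of p, where ?'c = real] by simp
    show ?thesis using 1 2 3 by (simp add: sum_subtractf)
  qed
  then have "(\<Sum>i<m. S i) + (\<Sum>j<l. T j) = (\<Sum>p\<leftarrow>ps. 1)"
    unfolding S_def T_def sum_list_sum_swap by (simp flip: sum_list_addf)
  also have "\<dots> = real (length ps)" by (simp add: sum_list_triv)
  finally have "real (length ps) = (\<Sum>i<m. S i) + (\<Sum>j<l. T j)" by simp
  also have "\<dots> \<le> (\<Sum>i<m. \<epsilon> * real (length ps)) + (\<Sum>j<l. \<epsilon> * real (length ps))"
  proof (intro add_mono sum_mono)
    have ind: "\<forall>x. \<bar>indicator E x :: real\<bar> \<le> 1" for E :: "'x set" by (simp add: indicator_def)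
    show "S i \<le> \<epsilon> * real (length ps)" if "i \<in> {..<m}" for i
      using small[of "gi i" "indicator (A i)"] ind that unfolding S_def by force
    show "T j \<le> \<epsilon> * real (length ps)" if "j \<in> {..<l}" for j
      using small[of "hi j" "indicator (B j)"] ind that unfolding T_def by force
  qed
  also have "\<dots> = real (m + l) * \<epsilon> * real (length ps)" by (simp add: algebra_simps)
  also have "\<dots> = real (length ps) / 2" unfolding \<epsilon>(2) by simp
  finally show False using ps by simp
qed

section \<open>Norms over a trivially valued field\<close>

locale trivially_valued_norm =
  fixes v :: "'k::field \<Rightarrow> real" and N :: "'k ^ 'n \<Rightarrow> real"
  assumes triv: "trivial_valuation v" and norm: "nonarch_norm v N"
begin

lemma N_nonneg: "0 \<le> N x" and N_eq_0_iff: "N x = 0 \<longleftrightarrow> x = 0" and N_add_le: "N (x + y) \<le> max (N x) (N y)"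
  using norm by (auto simp: nonarch_norm_def)

lemma N_scale: "c \<noteq> 0 \<Longrightarrow> N (c *s x) = N x"
  using norm triv by (auto simp: nonarch_norm_def trivial_valuation_def)

lemma N_scale_le: "N (c *s x) \<le> N x"
  using N_scale[of c x] N_nonneg[of x] N_eq_0_iff[of 0] by (cases "c = 0") auto

lemma N_minus: "N (- x) = N x"
  using N_scale[of "- 1" x] by (simp add: vector_sneg_minus1[symmetric])

lemma N_diff_le: "N (x - y) \<le> max (N x) (N y)"
  using N_add_le[of x "- y"] by (simp add: N_minus)

lemma N_add_less: "N x < r \<Longrightarrow> N y < r \<Longrightarrow> N (x + y) < r"
  by (rule le_less_trans[OF N_add_le]) simp

lemma N_diff_less: "N x < r \<Longrightarrow> N y < r \<Longrightarrow> N (x - y) < r"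
  by (rule le_less_trans[OF N_diff_le]) simp

lemma N_add_leI: "N x \<le> r \<Longrightarrow> N y \<le> r \<Longrightarrow> N (x + y) \<le> r"
  by (rule order_trans[OF N_add_le]) simp

lemma N_diff_leI: "N x \<le> r \<Longrightarrow> N y \<le> r \<Longrightarrow> N (x - y) \<le> r"
  by (rule order_trans[OF N_diff_le]) simp

lemma N_add_eq: "N (x + y) = N x" if "N y < N x"
  using that N_add_le[of x y] N_diff_le[of "x + y" y] by (auto simp: max_def split: if_splits)

text \<open>
  Among nonzero multiples of vectors of distinct norms the one of largest norm determines the norm of the
  sum, so subtracting it lowers the norm.
\<close>
lemma leading_term:
  assumes "finite B" "inj_on N B" "0 \<notin> B" "x \<in> vec.span B" "x \<noteq> 0"
  shows "\<exists>b\<in>B. \<exists>c. c \<noteq> 0 \<and> N b = N x \<and> N (x - c *s b) < N x"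
  using assms
proof (induction B arbitrary: x rule: finite_induct)
  case empty
  then show ?case by simp
next
  case (insert b B)
  obtain k where k: "x - k *s b \<in> vec.span B"
    using insert.prems by (auto simp: vec.span_breakdown_eq)
  define y where "y = x - k *s b"
  have x: "x = k *s b + y" by (simp add: y_def)
  have b0: "b \<noteq> 0" "0 < N b" using insert.prems N_nonneg[of b] N_eq_0_iff[of b] by (auto simp: less_le)
  have IH: "\<exists>b'\<in>B. \<exists>c. c \<noteq> 0 \<and> N b' = N y \<and> N (y - c *s b') < N y" if "y \<noteq> 0"
    using insert.IH[of y] insert.prems k that by (auto simp: y_def)
  show ?case
  proof (cases "k = 0")
    case True
    then show ?thesis using IH x insert.prems by auto
  next
    case k0: False
    then have Nk: "N (k *s b) = N b" by (rule N_scale)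
    show ?thesis
    proof (cases "y = 0 \<or> N y < N b")
      case True
      then have small: "N y < N b" using b0 N_eq_0_iff[of 0] by auto
      then have "N x = N b" unfolding x using N_add_eq[of y "k *s b"] Nk by simp
      moreover have "N (x - k *s b) < N b" using small by (simp add: x)
      ultimately show ?thesis using k0 by (intro bexI[of _ b] exI[of _ k]) auto
    next
      case False
      then obtain b' c where b': "b' \<in> B" "c \<noteq> 0" "N b' = N y" "N (y - c *s b') < N y"
        using IH by blast
      then have "N b' \<noteq> N b" using insert.hyps insert.prems by (auto simp: inj_on_def)
      then have less: "N b < N y" using False b' by auto
      have "N x = N y" unfolding x using N_add_eq[of "k *s b" y] Nk less by (simp add: add.commute)
      moreover have "N (x - c *s b') < N y"
      proof -
        have "x - c *s b' = k *s b + (y - c *s b')" by (simp add: x)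
        then show ?thesis
          using N_add_le[of "k *s b" "y - c *s b'"] Nk less b' by (simp only: max_def) (simp split: if_splits)
      qed
      ultimately show ?thesis using b' by (intro bexI[of _ b'] exI[of _ c]) auto
    qed
  qed
qed

lemma independent_if_distinct_norms:
  assumes "finite B" "inj_on N B" "0 \<notin> B"
  shows "vec.independent B"
  unfolding vec.dependent_def
proof safe
  fix a assume a: "a \<in> B" "a \<in> vec.span (B - {a})"
  have "\<exists>b\<in>B - {a}. \<exists>c. c \<noteq> 0 \<and> N b = N a \<and> N (a - c *s b) < N a"
    by (rule leading_term) (use assms a in \<open>auto intro: inj_on_diff\<close>)
  then show False using assms a by (auto simp: inj_on_def)
qed

lemma exists_family_with_norms:
  assumes "Vs \<subseteq> range N - {0}" "finite Vs"
  obtains B where "finite B" "inj_on N B" "0 \<notin> B" "N ` B = Vs" "card B = card Vs"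
proof
  define b where "b r = (SOME x. N x = r)" for r
  have b: "N (b r) = r" if "r \<in> Vs" for r
    unfolding b_def by (rule someI_ex) (use assms that in auto)
  show "finite (b ` Vs)" using assms by simp
  show "inj_on N (b ` Vs)" using b by (auto simp: inj_on_def)
  show "0 \<notin> b ` Vs" using b assms N_eq_0_iff[of 0] by force
  show "N ` b ` Vs = Vs" using b by force
  show "card (b ` Vs) = card Vs" by (rule card_image) (metis b inj_onI)
qed

text \<open>
  A vector whose norm is below \<open>r\<close> has vanishing coordinates and is fixed by the linear part. Any other
  vector is changed by a vector of norm at most \<open>r\<close>, and both it and its image have norm at least \<open>r\<close>.
\<close>
lemma affine_isometry_two_plane:
  assumes lin: "\<And>x y. \<phi> (x + y) = \<phi> x + \<phi> y" "\<And>c x. \<phi> (c *s x) = c * \<phi> x"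
      "\<And>x y. \<psi> (x + y) = \<psi> x + \<psi> y" "\<And>c x. \<psi> (c *s x) = c * \<psi> x"
    and dual: "\<phi> e = 1" "\<phi> f = 0" "\<psi> e = 0" "\<psi> f = 1"
    and e: "N e \<le> r" "N f \<le> r" and r: "\<And>x. \<phi> x \<noteq> 0 \<or> \<psi> x \<noteq> 0 \<Longrightarrow> r \<le> N x"
    and "\<alpha> \<noteq> 0" "\<beta> \<noteq> 0"
  shows "affine_isometry N (\<lambda>x. x + ((\<alpha> - 1) * (\<phi> x - c)) *s e + ((\<beta> - 1) * (\<psi> x - d)) *s f)"
proof -
  define L where "L x = x + ((\<alpha> - 1) * \<phi> x) *s e + ((\<beta> - 1) * \<psi> x) *s f" for x
  have "Vector_Spaces.linear (*s) (*s) L"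
    by unfold_locales
      (simp_all add: L_def lin vec.scale_left_distrib vec.scale_right_distrib distrib_left
        vec.scale_scale mult.left_commute)
  then have A: "matrix L *v x = L x" for x by (rule matrix_works)
  have \<phi>L: "\<phi> (L x) = \<alpha> * \<phi> x" and \<psi>L: "\<psi> (L x) = \<beta> * \<psi> x" for x
    unfolding L_def lin dual by (simp_all add: algebra_simps)
  have diff: "N (L x - x) \<le> r" for x
  proof -
    have "L x - x = ((\<alpha> - 1) * \<phi> x) *s e + ((\<beta> - 1) * \<psi> x) *s f" by (simp add: L_def)
    then show ?thesis
      using N_add_le[of "((\<alpha> - 1) * \<phi> x) *s e" "((\<beta> - 1) * \<psi> x) *s f"] e
        N_scale_le[of "(\<alpha> - 1) * \<phi> x" e] N_scale_le[of "(\<beta> - 1) * \<psi> x" f] by auto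
  qed
  have NL: "N (L x) = N x" for x
  proof (cases "\<phi> x = 0 \<and> \<psi> x = 0")
    case True then show ?thesis by (simp add: L_def)
  next
    case False
    then have 1: "r \<le> N x" using r by blast
    have "\<phi> (L x) \<noteq> 0 \<or> \<psi> (L x) \<noteq> 0" using False assms(12,13) by (simp add: \<phi>L \<psi>L)
    then have 2: "r \<le> N (L x)" using r by blast
    have "N (L x) \<le> max (N (L x - x)) (N x)" using N_add_le[of "L x - x" x] by simp
    then have le: "N (L x) \<le> N x" using diff[of x] 1 by linarith
    have "N x \<le> max (N (L x - x)) (N (L x))" using N_diff_le[of "L x" "L x - x"] by simp
    then show ?thesis using diff[of x] 2 le by linarith
  qed
  have "inj ((*v) (matrix L))"
  proof (rule injI)
    fix x y assume "matrix L *v x = matrix L *v y"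
    then have "L (x - y) = 0" by (simp add: A[symmetric] matrix_vector_mult_diff_distrib)
    then have "N (x - y) = 0" using NL[of "x - y"] N_eq_0_iff[of 0] by simp
    then show "x = y" by (simp add: N_eq_0_iff)
  qed
  then have "invertible (matrix L)"
    by (simp add: invertible_left_inverse matrix_left_invertible_injective)
  moreover have "N (matrix L *v x) = N x" for x by (simp add: A NL)
  moreover have "(\<lambda>x. x + ((\<alpha> - 1) * (\<phi> x - c)) *s e + ((\<beta> - 1) * (\<psi> x - d)) *s f) =
      (\<lambda>x. matrix L *v x + (- (((\<alpha> - 1) * c) *s e) - ((\<beta> - 1) * d) *s f))"
    by (rule ext) (simp add: A L_def right_diff_distrib vec.scale_left_diff_distrib)
  ultimately show ?thesis unfolding affine_isometry_def by blast
qed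

text \<open>
  Choose one vector for every value of the norm. Their span is not the whole space; let \<open>f\<close> be a vector of
  least norm \<open>r\<close> outside it, and \<open>e\<close> the chosen vector of norm \<open>r\<close>. By minimality \<open>e\<close> and \<open>f\<close> are independent
  modulo the subspace of vectors of norm less than \<open>r\<close>.
\<close>
lemma exists_equal_norm_plane:
  assumes "finite (range N - {0})" "card (range N - {0}) < CARD('n)"
  obtains e f \<phi> \<psi> r where
    "\<And>x y. \<phi> (x + y) = \<phi> x + \<phi> y" "\<And>c x. \<phi> (c *s x) = c * \<phi> x"
    "\<And>x y. \<psi> (x + y) = \<psi> x + \<psi> y" "\<And>c x. \<psi> (c *s x) = c * \<psi> x"
    "\<phi> e = 1" "\<phi> f = 0" "\<psi> e = 0" "\<psi> f = 1"
    "N e \<le> r" "N f \<le> r" "\<And>x. \<phi> x \<noteq> 0 \<or> \<psi> x \<noteq> 0 \<Longrightarrow> r \<le> N x"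
proof -
  obtain B where B: "finite B" "inj_on N B" "0 \<notin> B" "N ` B = range N - {0}" "card B = card (range N - {0})"
    by (rule exists_family_with_norms[OF order_refl assms(1)]) (rule that)
  have "vec.dim (UNIV :: ('k ^ 'n) set) = CARD('n)" by (rule vec_dim_card)
  then have "vec.span B \<noteq> UNIV"
    using vec.dim_le_card[of UNIV B] B assms(2) by auto
  define S where "S = - vec.span B"
  have fin: "finite (N ` S)"
    by (rule finite_subset[of _ "insert 0 (range N - {0})"]) (use assms in auto)
  have "N ` S \<noteq> {}" using \<open>vec.span B \<noteq> UNIV\<close> by (auto simp: S_def)
  then have "Min (N ` S) \<in> N ` S" by (rule Min_in[OF fin])
  then obtain f where f: "f \<in> S" "N f = Min (N ` S)" by auto
  then have f_min: "N f \<le> N y" if "y \<in> S" for y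
    using Min_le[OF fin] that by auto
  define r where "r = N f"
  have "f \<noteq> 0" using f vec.span_zero by (auto simp: S_def)
  then have "r \<in> N ` B" unfolding B(4) r_def by (auto simp: N_eq_0_iff)
  then obtain e where e: "e \<in> B" "N e = r" by auto
  define W where "W = {x. N x < r}"
  have r0: "0 < r" using \<open>f \<noteq> 0\<close> N_nonneg[of f] by (auto simp: r_def less_le N_eq_0_iff)
  have W: "vec.subspace W"
  proof (rule vec.subspaceI)
    show "0 \<in> W" using r0 N_eq_0_iff[of 0] by (simp add: W_def)
    show "x + y \<in> W" if "x \<in> W" "y \<in> W" for x y
      using that N_add_le[of x y] by (auto simp: W_def)
    show "c *s x \<in> W" if "x \<in> W" for c x
      using that N_scale_le[of c x] by (auto simp: W_def)
  qed
  obtain C where C: "C \<subseteq> W" "vec.independent C" "W \<subseteq> vec.span C"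
    using vec.maximal_independent_subset[of W] by blast
  then have span_C: "vec.span C = W" using W vec.span_minimal by blast
  have "e \<notin> vec.span C" unfolding span_C by (simp add: W_def e)
  then have ind_e: "vec.independent (insert e C)"
    using C vec.span_base by (auto simp: vec.independent_insert)
  have "f \<notin> vec.span (insert e C)"
  proof
    assume "f \<in> vec.span (insert e C)"
    then obtain k where "f - k *s e \<in> vec.span C" by (auto simp: vec.span_breakdown_eq)
    then have "N (f - k *s e) < r" unfolding span_C by (simp add: W_def)
    moreover have "f - k *s e \<in> S"
    proof (rule ccontr)
      assume "f - k *s e \<notin> S"
      then have "f - k *s e \<in> vec.span B" by (simp add: S_def)
      from vec.span_add[OF this vec.span_scale[OF vec.span_base[OF e(1)], of k]]
      have "f \<in> vec.span B" by simp
      then show False using f by (simp add: S_def)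
    qed
    ultimately show False using f_min[of "f - k *s e"] by (simp add: r_def)
  qed
  note f1 = this
  have f2: "f \<notin> vec.span C" using f1 vec.span_mono[of C "insert e C"] by blast
  have f3: "f \<noteq> e" using f1 vec.span_base[of e "insert e C"] by blast
  have f4: "vec.independent (insert f (insert e C))"
    by (rule vec.independent_insertI[OF f1 ind_e])
  note f_notin = f2 f3 f4
  have functional: "\<exists>\<phi>. (\<forall>x y. \<phi> (x + y) = \<phi> x + \<phi> y) \<and> (\<forall>c x. \<phi> (c *s x) = c * \<phi> x) \<and>
      \<phi> a = 1 \<and> \<phi> b = 0 \<and> (\<forall>x. \<phi> x \<noteq> 0 \<longrightarrow> r \<le> N x)" if ab: "{a, b} = {e, f}" "a \<noteq> b" for a b
  proof -
    let ?v = "\<lambda>x. if x = a then 1 else (0 :: 'k ^ 'n)"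
    from vec.linear_independent_extend[OF f_notin(3), of ?v]
    obtain g where g: "Vector_Spaces.linear (*s) (*s) g \<and> (\<forall>x\<in>insert f (insert e C). g x = ?v x)"
      by (elim exE) (rule that)
    note g = conjunct1[OF g] conjunct2[OF g]
    interpret g: Vector_Spaces.linear "(*s)" "(*s)" g by (rule g)
    have C_a: "a \<notin> C" using \<open>e \<notin> vec.span C\<close> f_notin(1) ab vec.span_base by (auto simp: doubleton_eq_iff)
    then have "g x = 0" if "x \<in> C" for x using g(2) that by auto
    then have gW: "g x = 0" if "x \<in> W" for x
      using g.eq_0_on_span[of C x] that span_C by blast
    let ?\<phi> = "\<lambda>x. g x $ undefined"
    have "r \<le> N x" if "?\<phi> x \<noteq> 0" for x
      using gW[of x] that unfolding W_def by (cases "N x < r") auto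
    moreover have "?\<phi> a = 1" "?\<phi> b = 0" using g(2) ab by (auto simp: doubleton_eq_iff)
    ultimately show ?thesis by (intro exI[of _ ?\<phi>]) (auto simp: g.add g.scale)
  qed
  obtain \<phi> where \<phi>: "\<forall>x y. \<phi> (x + y) = \<phi> x + \<phi> y" "\<forall>c x. \<phi> (c *s x) = c * \<phi> x"
      "\<phi> e = 1" "\<phi> f = 0" "\<forall>x. \<phi> x \<noteq> 0 \<longrightarrow> r \<le> N x"
    using functional[of e f] f_notin by auto
  obtain \<psi> where \<psi>: "\<forall>x y. \<psi> (x + y) = \<psi> x + \<psi> y" "\<forall>c x. \<psi> (c *s x) = c * \<psi> x"
      "\<psi> f = 1" "\<psi> e = 0" "\<forall>x. \<psi> x \<noteq> 0 \<longrightarrow> r \<le> N x"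
    using functional[OF insert_commute f3] by blast
  show thesis
    by (rule that[of \<phi> \<psi> e f r]) (use \<phi> \<psi> e r_def in auto)
qed

end

section \<open>Complete flags: the isometries form an amenable group\<close>

context trivially_valued_norm
begin

definition isometries :: "('k ^ 'n \<Rightarrow> 'k ^ 'n) set" where
  "isometries = {f. affine_isometry N f}"

text \<open>
  The next three sets are the members of the subnormal series. A map that preserves a flag acts on its
  quotients; \<open>displacing_at_most r\<close> is the kernel of the action on the quotient by the closed ball of
  radius \<open>r\<close>, and \<open>displacing_less r\<close> that for the open ball.
\<close>
definition displacing_less :: "real \<Rightarrow> ('k ^ 'n \<Rightarrow> 'k ^ 'n) set" where
  "displacing_less r = {f \<in> isometries. \<forall>x. N (f x - x) < r}"

definition displacing_at_most :: "real \<Rightarrow> ('k ^ 'n \<Rightarrow> 'k ^ 'n) set" where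
  "displacing_at_most r = {f \<in> isometries. \<forall>x. N (f x - x) \<le> r}"

definition unipotent_displacing :: "real \<Rightarrow> ('k ^ 'n \<Rightarrow> 'k ^ 'n) set" where
  "unipotent_displacing r =
    {f \<in> displacing_at_most r. \<forall>x y. N (x - y) \<le> r \<longrightarrow> N ((f x - f y) - (x - y)) < r}"

lemma isometries_linear_part:
  assumes "f \<in> isometries"
  obtains L where "\<And>x y. L (x + y) = L x + L y" "\<And>x y. L (x - y) = L x - L y"
    "\<And>c x. L (c *s x) = c *s L x" "\<And>x. N (L x) = N x" "\<And>x y. f x - f y = L (x - y)"
proof -
  obtain A t where A: "\<And>x. N (A *v x) = N x" "f = (\<lambda>x. A *v x + t)"
    using assms unfolding isometries_def affine_isometry_def by blast
  show thesis
    by (rule that[of "(*v) A"])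
      (simp_all add: A matrix_vector_right_distrib matrix_vector_mult_diff_distrib vec.scale)
qed

lemma isometriesD: "f \<in> isometries \<Longrightarrow> N (f x - f y) = N (x - y)"
  by (metis isometries_linear_part)

lemma isometries_comp: "f \<in> isometries \<Longrightarrow> g \<in> isometries \<Longrightarrow> f \<circ> g \<in> isometries"
  unfolding isometries_def by (simp add: affine_isometry_comp)

lemma id_isometries: "id \<in> isometries"
  unfolding isometries_def by (simp add: affine_isometry_id)

lemma isometries_inverse:
  assumes "f \<in> isometries"
  obtains k where "k \<in> isometries" "k \<circ> f = id" "f \<circ> k = id"
  using affine_isometry_left_inverse[of N f] assms unfolding isometries_def by blast

text \<open>
  The size of the commutator of \<open>f\<close> and \<open>g\<close> is that of the failure of \<open>f\<close> and \<open>g\<close> to commute, since \<open>g \<circ> f\<close> is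
  an isometry.
\<close>
lemma commutator:
  assumes f: "f \<in> isometries" and g: "g \<in> isometries"
  obtains c where "c \<in> isometries" "f \<circ> g = g \<circ> f \<circ> c"
    "\<And>x. N (c x - x) = N (f (g x) - g (f x))"
    "\<And>x y. N ((c x - c y) - (x - y)) = N ((f (g x) - f (g y)) - (g (f x) - g (f y)))"
proof -
  have gf: "g \<circ> f \<in> isometries" by (rule isometries_comp[OF g f])
  obtain k where k: "k \<in> isometries" "k \<circ> (g \<circ> f) = id" "(g \<circ> f) \<circ> k = id"
    by (rule isometries_inverse[OF gf]) (rule that)
  define c where "c = k \<circ> (f \<circ> g)"
  have c: "c \<in> isometries" unfolding c_def by (intro isometries_comp k f g)
  have eq: "f \<circ> g = g \<circ> f \<circ> c"
    unfolding c_def by (metis comp_assoc id_comp k(3))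
  then have fg: "f (g x) = g (f (c x))" for x by (metis comp_apply)
  obtain L where L: "\<And>x y. L (x + y) = L x + L y" "\<And>x y. L (x - y) = L x - L y"
    "\<And>c x. L (c *s x) = c *s L x" "\<And>x. N (L x) = N x" "\<And>x y. (g \<circ> f) x - (g \<circ> f) y = L (x - y)"
    by (rule isometries_linear_part[OF gf]) (rule that)
  have L5: "g (f x) - g (f y) = L (x - y)" for x y using L(5)[of x y] by simp
  have 1: "N (c x - x) = N (f (g x) - g (f x))" for x
    unfolding fg L5 L(4) ..
  have 2: "N ((c x - c y) - (x - y)) = N ((f (g x) - f (g y)) - (g (f x) - g (f y)))" for x y
    unfolding fg L5 L(2)[symmetric] L(4) ..
  show thesis by (rule that[OF c eq 1 2])
qed

lemma displacing_comp:
  "f \<in> displacing_less r \<Longrightarrow> g \<in> displacing_less r \<Longrightarrow> f \<circ> g \<in> displacing_less r"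
  "f \<in> displacing_at_most r \<Longrightarrow> g \<in> displacing_at_most r \<Longrightarrow> f \<circ> g \<in> displacing_at_most r"
  "f \<in> unipotent_displacing r \<Longrightarrow> g \<in> unipotent_displacing r \<Longrightarrow> f \<circ> g \<in> unipotent_displacing r"
proof -
  have split: "f (g x) - x = (f (g x) - g x) + (g x - x)" for f g and x :: "'k ^ 'n" by simp
  show "f \<circ> g \<in> displacing_less r" if "f \<in> displacing_less r" "g \<in> displacing_less r" for f g
  proof -
    have "N (f (g x) - x) < r" for x
      unfolding split[of f g x] by (rule N_add_less) (use that in \<open>auto simp: displacing_less_def\<close>)
    then show ?thesis using that isometries_comp unfolding displacing_less_def by auto
  qed
  show displacing_at_most: "f \<circ> g \<in> displacing_at_most r" if "f \<in> displacing_at_most r" "g \<in> displacing_at_most r" for f g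
  proof -
    have "N (f (g x) - x) \<le> r" for x
      unfolding split[of f g x] by (rule N_add_leI) (use that in \<open>auto simp: displacing_at_most_def\<close>)
    then show ?thesis using that isometries_comp unfolding displacing_at_most_def by auto
  qed
  show "f \<circ> g \<in> unipotent_displacing r" if fg: "f \<in> unipotent_displacing r" "g \<in> unipotent_displacing r" for f g
  proof -
    have w: "f \<in> displacing_at_most r" "g \<in> displacing_at_most r"
      and uf: "\<And>x y. N (x - y) \<le> r \<Longrightarrow> N ((f x - f y) - (x - y)) < r"
      and ug: "\<And>x y. N (x - y) \<le> r \<Longrightarrow> N ((g x - g y) - (x - y)) < r"
      using fg unfolding unipotent_displacing_def by blast+
    have "N ((f (g x) - f (g y)) - (x - y)) < r" if xy: "N (x - y) \<le> r" for x y
    proof -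
      have "g \<in> isometries" using w by (simp add: displacing_at_most_def)
      then have "N (g x - g y) \<le> r" using xy isometriesD by simp
      then have "N ((f (g x) - f (g y)) - (g x - g y)) < r" by (rule uf)
      from N_add_less[OF this ug[OF xy]] show ?thesis by (simp add: algebra_simps)
    qed
    then show ?thesis using displacing_at_most[OF w] unfolding unipotent_displacing_def by simp
  qed
qed

lemma id_displacing:
  "0 < r \<Longrightarrow> id \<in> displacing_less r" "0 < r \<Longrightarrow> id \<in> unipotent_displacing r"
  using N_eq_0_iff[of 0] id_isometries
  by (auto simp: displacing_less_def unipotent_displacing_def displacing_at_most_def)

text \<open>
  Modulo the open ball of radius \<open>r\<close>, both maps are translations on each coset of the closed ball, and
  translations commute.
\<close>
lemma almost_invariant_unipotent_displacing:
  assumes "0 < r" "almost_invariant (displacing_less r)"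
  shows "almost_invariant (unipotent_displacing r)"
proof (rule almost_invariant_abelian_extension[OF assms(2)])
  show "displacing_less r \<subseteq> unipotent_displacing r"
  proof
    fix f assume f: "f \<in> displacing_less r"
    have "N ((f x - f y) - (x - y)) < r" for x y
    proof -
      have "N (f x - x) < r" "N (f y - y) < r" using f by (auto simp: displacing_less_def)
      then have "N ((f x - x) - (f y - y)) < r" by (rule N_diff_less)
      moreover have "(f x - x) - (f y - y) = (f x - f y) - (x - y)" by simp
      ultimately show ?thesis by simp
    qed
    then show "f \<in> unipotent_displacing r"
      using f unfolding displacing_less_def unipotent_displacing_def displacing_at_most_def by (auto intro: less_imp_le)
  qed
  fix f g assume fg: "f \<in> unipotent_displacing r" "g \<in> unipotent_displacing r"
  then have iso: "f \<in> isometries" "g \<in> isometries"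
    and f: "\<And>x. N (f x - x) \<le> r" "\<And>x y. N (x - y) \<le> r \<Longrightarrow> N ((f x - f y) - (x - y)) < r"
    and g: "\<And>x. N (g x - x) \<le> r" "\<And>x y. N (x - y) \<le> r \<Longrightarrow> N ((g x - g y) - (x - y)) < r"
    unfolding unipotent_displacing_def displacing_at_most_def by blast+
  obtain c where c: "c \<in> isometries" "f \<circ> g = g \<circ> f \<circ> c"
    "\<And>x. N (c x - x) = N (f (g x) - g (f x))"
    "\<And>x y. N ((c x - c y) - (x - y)) = N ((f (g x) - f (g y)) - (g (f x) - g (f y)))"
    by (rule commutator[OF iso]) (rule that)
  have "N (f (g x) - g (f x)) < r" for x
  proof -
    have "N (((f (g x) - f x) - (g x - x)) - ((g (f x) - g x) - (f x - x))) < r"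
      by (intro N_diff_less[OF f(2) g(2)] f(1) g(1))
    then show ?thesis by (simp add: algebra_simps)
  qed
  then have "c \<in> displacing_less r" using c by (simp add: displacing_less_def)
  then show "\<exists>c\<in>displacing_less r. f \<circ> g = g \<circ> f \<circ> c" using c(2) by blast
qed (use displacing_comp id_displacing assms in blast)+

text \<open>
  On the quotient of the closed by the open ball, which is a line, the linear parts act as scalars, and scalars
  commute.
\<close>
lemma almost_invariant_displacing_at_most:
  assumes "0 < r" "almost_invariant (unipotent_displacing r)"
    and line: "\<And>x y. N x = r \<Longrightarrow> N y = r \<Longrightarrow> \<exists>c. N (x - c *s y) < r"
  shows "almost_invariant (displacing_at_most r)"
proof (rule almost_invariant_abelian_extension[OF assms(2)])
  show "unipotent_displacing r \<subseteq> displacing_at_most r" by (auto simp: unipotent_displacing_def)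
  fix f g assume fg: "f \<in> displacing_at_most r" "g \<in> displacing_at_most r"
  then have iso: "f \<in> isometries" "g \<in> isometries"
    and f: "\<And>x. N (f x - x) \<le> r" and g: "\<And>x. N (g x - x) \<le> r"
    unfolding displacing_at_most_def by blast+
  obtain c where c: "c \<in> isometries" "f \<circ> g = g \<circ> f \<circ> c"
    "\<And>x. N (c x - x) = N (f (g x) - g (f x))"
    "\<And>x y. N ((c x - c y) - (x - y)) = N ((f (g x) - f (g y)) - (g (f x) - g (f y)))"
    by (rule commutator[OF iso]) (rule that)
  obtain L where L: "\<And>x y. L (x + y) = L x + L y" "\<And>x y. L (x - y) = L x - L y"
    "\<And>c x. L (c *s x) = c *s L x" "\<And>x. N (L x) = N x" "\<And>x y. f x - f y = L (x - y)"
    by (rule isometries_linear_part[OF iso(1)]) (rule that)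
  obtain M where M: "\<And>x y. M (x + y) = M x + M y" "\<And>x y. M (x - y) = M x - M y"
    "\<And>c x. M (c *s x) = c *s M x" "\<And>x. N (M x) = N x" "\<And>x y. g x - g y = M (x - y)"
    by (rule isometries_linear_part[OF iso(2)]) (rule that)
  have comm: "N (L (M d) - M (L d)) < r" if d: "N d \<le> r" for d
  proof (cases "N d < r")
    case True
    then show ?thesis by (intro N_diff_less) (simp_all add: L M)
  next
    case False
    then have Nd: "N d = r" using d by simp
    obtain a where a: "N (L d - a *s d) < r" using line[of "L d" d] L Nd by auto
    obtain b where b: "N (M d - b *s d) < r" using line[of "M d" d] M Nd by auto
    define s t where "s = L d - a *s d" and "t = M d - b *s d"
    have "L (M d) = b *s (a *s d + s) + L t"
      using L(1)[of "b *s d" t] by (simp add: s_def t_def L(3))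
    moreover have "M (L d) = a *s (b *s d + t) + M s"
      using M(1)[of "a *s d" s] by (simp add: s_def t_def M(3))
    ultimately have eq: "L (M d) - M (L d) = (b *s s + L t) - (a *s t + M s)"
      by (simp add: vec.scale_right_distrib vec.scale_left_commute)
    have "N (b *s s) < r" "N (a *s t) < r" "N (L t) < r" "N (M s) < r"
      using a b N_scale_le[of b s] N_scale_le[of a t] by (auto simp: s_def t_def L(4) M(4))
    then show ?thesis unfolding eq by (intro N_diff_less N_add_less)
  qed
  have "N (c x - x) \<le> r" for x
  proof -
    have eq: "f (g x) - g (f x) = ((f (g x) - g x) + (g x - x)) - ((g (f x) - f x) + (f x - x))" by simp
    show ?thesis unfolding c(3) eq by (intro N_diff_leI N_add_leI f g)
  qed
  moreover have "N ((c x - c y) - (x - y)) < r" if "N (x - y) \<le> r" for x y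
    unfolding c(4) L(5) M(5) by (rule comm[OF that])
  ultimately have "c \<in> unipotent_displacing r" using c(1) by (simp add: unipotent_displacing_def displacing_at_most_def)
  then show "\<exists>c\<in>unipotent_displacing r. f \<circ> g = g \<circ> f \<circ> c" using c(2) by blast
qed (use displacing_comp id_displacing assms in blast)+

text \<open>
  Induction over the finitely many values of the norm: below the least one only the identity is left, and
  \<open>displacing_less r\<close> is \<open>displacing_at_most q\<close> for the largest value \<open>q\<close> below \<open>r\<close>.
\<close>
lemma almost_invariant_isometries:
  assumes fin: "finite (range N)"
    and line: "\<And>x y. N x = N y \<Longrightarrow> y \<noteq> 0 \<Longrightarrow> \<exists>c. N (x - c *s y) < N y"
  shows "almost_invariant isometries"
proof -
  have "almost_invariant (displacing_less r)" if "0 < r" for r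
    using that
  proof (induction "card {s \<in> range N - {0}. s < r}" arbitrary: r rule: less_induct)
    case less
    let ?S = "\<lambda>r. {s \<in> range N - {0}. s < r}"
    have finS: "finite (?S r)" for r using fin by auto
    show ?case
    proof (cases "?S r = {}")
      case True
      have "f = id" if "f \<in> displacing_less r" for f
      proof
        fix x
        have "N (f x - x) < r" using that by (simp add: displacing_less_def)
        then have "N (f x - x) = 0" using True by blast
        then show "f x = id x" by (simp add: N_eq_0_iff)
      qed
      then have "displacing_less r \<subseteq> {id}" by blast
      then show ?thesis using almost_invariant_mono[OF almost_invariant_singleton_id] by blast
    next
      case False
      define q where "q = Max (?S r)"
      have q: "q \<in> ?S r" unfolding q_def using finS False by (rule Max_in)
      then have "0 < q" using N_nonneg by (auto simp: less_le)
      have "?S q \<subset> ?S r" using q by auto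
      then have "card (?S q) < card (?S r)" by (rule psubset_card_mono[OF finS])
      then have "almost_invariant (displacing_less q)" using less.hyps \<open>0 < q\<close> by blast
      then have "almost_invariant (unipotent_displacing q)"
        by (rule almost_invariant_unipotent_displacing[OF \<open>0 < q\<close>])
      then have "almost_invariant (displacing_at_most q)"
      proof (rule almost_invariant_displacing_at_most[OF \<open>0 < q\<close>])
        fix x y assume "N x = q" "N y = q"
        then show "\<exists>c. N (x - c *s y) < q"
          using line[of x y] \<open>0 < q\<close> N_eq_0_iff[of y] by auto
      qed
      moreover have "displacing_less r \<subseteq> displacing_at_most q"
      proof
        fix f assume f: "f \<in> displacing_less r"
        have "N (f x - x) \<le> q" for x
        proof (cases "N (f x - x) = 0")
          case True then show ?thesis using \<open>0 < q\<close> by simp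
        next
          case False
          then have "N (f x - x) \<in> ?S r" using f by (auto simp: displacing_less_def)
          then show ?thesis unfolding q_def by (rule Max_ge[OF finS])
        qed
        then show "f \<in> displacing_at_most q" using f by (simp add: displacing_less_def displacing_at_most_def)
      qed
      ultimately show ?thesis by (rule almost_invariant_mono)
    qed
  qed
  moreover have "isometries \<subseteq> displacing_less (Max (range N) + 1)"
  proof
    fix f assume "f \<in> isometries"
    moreover have "N y < Max (range N) + 1" for y
      using Max_ge[OF fin rangeI, of y] by linarith
    ultimately show "f \<in> displacing_less (Max (range N) + 1)" by (simp add: displacing_less_def)
  qed
  moreover have "0 < Max (range N) + 1"
    using Max_ge[OF fin rangeI, of 0] N_nonneg[of 0] by linarith
  ultimately show ?thesis using almost_invariant_mono by blast
qed

text \<open>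
  Vectors realising \<open>n\<close> values form a basis, and any two vectors of equal norm have proportional leading terms.
\<close>
lemma many_norms_imp_full_flag:
  assumes "\<not> (finite (range N - {0}) \<and> card (range N - {0}) < CARD('n))"
  shows "finite (range N)" "\<And>x y. N x = N y \<Longrightarrow> y \<noteq> 0 \<Longrightarrow> \<exists>c. N (x - c *s y) < N y"
proof -
  obtain Vs where Vs: "Vs \<subseteq> range N - {0}" "finite Vs" "card Vs = CARD('n)"
  proof (cases "finite (range N - {0})")
    case True
    then show ?thesis using assms obtain_subset_with_card_n[of "CARD('n)" "range N - {0}"] that
      by (metis not_less finite_subset)
  next
    case False
    then show ?thesis using infinite_arbitrarily_large[of "range N - {0}" "CARD('n)"] that by blast
  qed
  obtain B where B: "finite B" "inj_on N B" "0 \<notin> B" "N ` B = Vs" "card B = card Vs"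
    by (rule exists_family_with_norms[OF Vs(1,2)]) (rule that)
  have "vec.dim (UNIV :: ('k ^ 'n) set) \<le> card B" by (simp only: vec_dim_card B Vs)
  then have span: "vec.span B = UNIV"
    using vec.card_ge_dim_independent[of B UNIV] independent_if_distinct_norms[OF B(1-3)] by auto
  have lead: "\<exists>b\<in>B. \<exists>c. c \<noteq> 0 \<and> N b = N x \<and> N (x - c *s b) < N x" if "x \<noteq> 0" for x
    using leading_term[OF B(1-3) _ that] span by simp
  have "N x \<in> insert 0 (N ` B)" for x
  proof (cases "x = 0")
    case True then show ?thesis using N_eq_0_iff[of 0] by simp
  next
    case False
    then obtain b where "b \<in> B" "N b = N x" using lead by blast
    then show ?thesis by (metis imageI insertCI)
  qed
  then have "range N \<subseteq> insert 0 (N ` B)" by blast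
  then show "finite (range N)" using B(1) finite_subset by blast
  show "\<exists>c. N (x - c *s y) < N y" if xy: "N x = N y" "y \<noteq> 0" for x y
  proof -
    have "x \<noteq> 0" using xy N_eq_0_iff[of 0] N_eq_0_iff[of y] by auto
    then obtain b c where b: "b \<in> B" "c \<noteq> 0" "N b = N x" "N (x - c *s b) < N x" using lead by blast
    obtain b' c' where b': "b' \<in> B" "c' \<noteq> 0" "N b' = N y" "N (y - c' *s b') < N y"
      using lead[OF xy(2)] by blast
    have "b' = b" by (rule inj_onD[OF B(2) _ b'(1) b(1)]) (simp add: b b' xy)
    have eq: "x - (c / c') *s y = (x - c *s b) - (c / c') *s (y - c' *s b)"
      using b'(2) by (simp add: vec.scale_right_diff_distrib)
    have small: "N ((c / c') *s (y - c' *s b)) < N y"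
      using N_scale_le b'(4) unfolding \<open>b' = b\<close> by (rule le_less_trans)
    have "N (x - (c / c') *s y) < N y"
      unfolding eq by (rule N_diff_less[OF _ small]) (use b(4) xy(1) in simp)
    then show ?thesis by blast
  qed
qed

lemma not_paradoxical_if_many_norms:
  assumes "\<not> (finite (range N - {0}) \<and> card (range N - {0}) < CARD('n))"
  shows "\<not> paradoxical (affine_isometry_group N) UNIV (\<lambda>f. f) UNIV"
proof (rule not_paradoxical_if_almost_invariant)
  have carrier: "carrier (affine_isometry_group N) = isometries"
    by (simp add: affine_isometry_group_def isometries_def)
  show "almost_invariant (carrier (affine_isometry_group N))"
    unfolding carrier using many_norms_imp_full_flag[OF assms] by (rule almost_invariant_isometries)
  fix g assume "g \<in> carrier (affine_isometry_group N)"
  then show "\<exists>k\<in>carrier (affine_isometry_group N). k \<circ> g = id \<and> g \<circ> k = id"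
    unfolding carrier by (rule isometries_inverse) blast
qed

end

section \<open>Fields that are not locally finite\<close>

definition subring_set :: "'k::field set \<Rightarrow> bool" where
  "subring_set T \<longleftrightarrow> 1 \<in> T \<and> (\<forall>y\<in>T. \<forall>z\<in>T. y - z \<in> T \<and> y * z \<in> T)"

lemma subring_setD:
  assumes "subring_set T"
  shows "0 \<in> T" "1 \<in> T"
    "\<And>y z. y \<in> T \<Longrightarrow> z \<in> T \<Longrightarrow> y - z \<in> T"
    "\<And>y z. y \<in> T \<Longrightarrow> z \<in> T \<Longrightarrow> y + z \<in> T"
    "\<And>y z. y \<in> T \<Longrightarrow> z \<in> T \<Longrightarrow> y * z \<in> T"
    "\<And>y. y \<in> T \<Longrightarrow> - y \<in> T"
    "\<And>y n. y \<in> T \<Longrightarrow> y ^ n \<in> T"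
    "\<And>(I :: 'i set) w. (\<And>i. i \<in> I \<Longrightarrow> w i \<in> T) \<Longrightarrow> sum w I \<in> T"
proof -
  show one: "1 \<in> T"
    and diff: "\<And>y z. y \<in> T \<Longrightarrow> z \<in> T \<Longrightarrow> y - z \<in> T"
    and mult: "\<And>y z. y \<in> T \<Longrightarrow> z \<in> T \<Longrightarrow> y * z \<in> T"
    using assms by (auto simp: subring_set_def)
  show zero: "0 \<in> T" using diff[OF one one] by simp
  show neg: "- y \<in> T" if "y \<in> T" for y using diff[OF zero that] by simp
  show add: "y + z \<in> T" if "y \<in> T" "z \<in> T" for y z
    using diff[OF that(1) neg[OF that(2)]] by simp
  show "y ^ n \<in> T" if "y \<in> T" for y n
    using that by (induction n) (auto simp: one mult)
  show "sum w I \<in> T" if "\<And>i. i \<in> I \<Longrightarrow> w i \<in> T" for w and I :: "'i set"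
    using that by (induction I rule: infinite_finite_induct) (auto simp: zero add)
qed

definition poly_values :: "'k::field set \<Rightarrow> 'k \<Rightarrow> 'k set" where
  "poly_values T x = {poly f x |f. \<forall>i. Polynomial.coeff f i \<in> T}"

lemma subring_set_poly_values:
  assumes "subring_set T"
  shows "subring_set (poly_values T x)" "T \<subseteq> poly_values T x" "x \<in> poly_values T x"
proof -
  note T = subring_setD[OF assms]
  have const: "poly [:c:] x \<in> poly_values T x" if "c \<in> T" for c
    unfolding poly_values_def
    by (rule CollectI, rule exI[of _ "[:c:]"]) (use that T in \<open>auto simp: coeff_pCons split: nat.split\<close>)
  then show "T \<subseteq> poly_values T x" by auto
  have "poly [:0, 1:] x \<in> poly_values T x"
    unfolding poly_values_def
    by (rule CollectI, rule exI[of _ "[:0, 1:]"]) (use T in \<open>auto simp: coeff_pCons split: nat.split\<close>)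
  then show "x \<in> poly_values T x" by simp
  show "subring_set (poly_values T x)"
    unfolding subring_set_def
  proof (intro conjI ballI)
    show "1 \<in> poly_values T x" using const[OF T(2)] by simp
    fix y z assume "y \<in> poly_values T x" "z \<in> poly_values T x"
    then obtain f g where f: "y = poly f x" "\<forall>i. Polynomial.coeff f i \<in> T"
      and g: "z = poly g x" "\<forall>i. Polynomial.coeff g i \<in> T" by (auto simp: poly_values_def)
    have "\<forall>i. Polynomial.coeff (f - g) i \<in> T" using f g T by auto
    then show "y - z \<in> poly_values T x" unfolding poly_values_def f g
      by (intro CollectI exI[of _ "f - g"]) auto
    have "\<forall>i. Polynomial.coeff (f * g) i \<in> T" unfolding coeff_mult using f g by (auto intro!: T(5) T(8))
    then show "y * z \<in> poly_values T x" unfolding poly_values_def f g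
      by (intro CollectI exI[of _ "f * g"]) auto
  qed
qed

abbreviation finite_subring :: "'k::field set \<Rightarrow> bool" where
  "finite_subring T \<equiv> finite T \<and> subring_set T"

lemma finite_subringD:
  assumes "finite_subring T"
  shows "finite T" "0 \<in> T" "1 \<in> T"
    "\<And>y z. y \<in> T \<Longrightarrow> z \<in> T \<Longrightarrow> y - z \<in> T"
    "\<And>y z. y \<in> T \<Longrightarrow> z \<in> T \<Longrightarrow> y + z \<in> T"
    "\<And>y z. y \<in> T \<Longrightarrow> z \<in> T \<Longrightarrow> y * z \<in> T"
    "\<And>y. y \<in> T \<Longrightarrow> - y \<in> T"
    "\<And>(I :: 'i set) w. (\<And>i. i \<in> I \<Longrightarrow> w i \<in> T) \<Longrightarrow> sum w I \<in> T"
proof -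
  show "finite T" using assms by blast
  have "subring_set T" using assms by blast
  note D = subring_setD[OF this]
  show "0 \<in> T" "1 \<in> T" by (fact D)+
  show "\<And>y z. y \<in> T \<Longrightarrow> z \<in> T \<Longrightarrow> y - z \<in> T" by (fact D)
  show "\<And>y z. y \<in> T \<Longrightarrow> z \<in> T \<Longrightarrow> y + z \<in> T" by (fact D)
  show "\<And>y z. y \<in> T \<Longrightarrow> z \<in> T \<Longrightarrow> y * z \<in> T" by (fact D)
  show "\<And>y. y \<in> T \<Longrightarrow> - y \<in> T" by (fact D)
  show "\<And>(I :: 'i set) w. (\<And>i. i \<in> I \<Longrightarrow> w i \<in> T) \<Longrightarrow> sum w I \<in> T" by (fact D)
qed

lemma range_of_int_closed:
  fixes x y :: "'k::comm_ring_1"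
  assumes "x \<in> range of_int" "y \<in> range of_int"
  shows "x + y \<in> range of_int" "x - y \<in> range of_int" "x * y \<in> range of_int"
proof -
  obtain a b where "x = of_int a" "y = of_int b" using assms by auto
  then have "x + y = of_int (a + b)" "x - y = of_int (a - b)" "x * y = of_int (a * b)" by simp_all
  then show "x + y \<in> range of_int" "x - y \<in> range of_int" "x * y \<in> range of_int" by blast+
qed

lemma finite_subring_range_of_int:
  assumes "CHAR('k::field) > 0"
  shows "finite_subring (range (of_int :: int \<Rightarrow> 'k))"
proof -
  have "range (of_int :: int \<Rightarrow> 'k) \<subseteq> of_int ` {0..<int CHAR('k)}"
  proof clarify
    fix z :: int
    have "of_int z = (of_int (z mod int CHAR('k)) :: 'k)"
    proof -
      have "(of_int z :: 'k) = of_int (int CHAR('k) * (z div int CHAR('k)) + z mod int CHAR('k))"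
        by simp
      also have "\<dots> = of_int (z mod int CHAR('k))"
        by (simp only: of_int_add of_int_mult of_int_of_nat_eq of_nat_CHAR) simp
      finally show ?thesis .
    qed
    then show "(of_int z :: 'k) \<in> of_int ` {0..<int CHAR('k)}"
      using assms by auto
  qed
  then have "finite (range (of_int :: int \<Rightarrow> 'k))" by (rule finite_subset) auto
  moreover have "1 \<in> range (of_int :: int \<Rightarrow> 'k)" by (metis of_int_1 rangeI)
  ultimately show ?thesis
    unfolding subring_set_def by (intro conjI ballI) (simp_all add: range_of_int_closed)
qed

lemma inverse_in_finite_subring:
  fixes x :: "'k::field"
  assumes "finite_subring R" "x \<in> R"
  shows "inverse x \<in> R"
proof (cases "x = 0")
  case False
  have pow: "x ^ n \<in> R" for n using assms subring_setD(7) by blast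
  then have "\<not> inj (\<lambda>n. x ^ n)"
    using finite_subringD(1)[OF assms(1)]
    using finite_subset[of "range (\<lambda>n. x ^ n)" R] finite_imageD[of "\<lambda>n. x ^ n" UNIV] infinite_UNIV_nat
    by blast
  then obtain m n where mn: "m < n" "x ^ m = x ^ n"
    unfolding inj_def by (metis linorder_neqE_nat)
  then have "x ^ m * x ^ (n - m) = x ^ m * 1"
    by (metis le_add_diff_inverse less_imp_le mult_1_right power_add)
  then have "x ^ (n - m) = 1" using False by simp
  then have "x * x ^ (n - m - 1) = 1" using mn(1)
    by (cases "n - m") auto
  then have "inverse x = x ^ (n - m - 1)" using inverse_unique by metis
  then show ?thesis using pow by metis
qed (use assms finite_subringD(2) in simp)

text \<open>
  Division by the monic polynomial \<open>g\<close> replaces each power of \<open>u\<close> by the value of a polynomial of degree below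
  that of \<open>g\<close>, and there are finitely many such polynomials over the finite ring \<open>R\<close>.
\<close>
lemma finite_powers_of_monic_root:
  fixes u :: "'k::field"
  assumes "finite_subring R"
    and g: "Polynomial.lead_coeff g = 1" "\<And>i. Polynomial.coeff g i \<in> R" "poly g u = 0"
  shows "finite (range (\<lambda>n. u ^ n))"
proof -
  note R = finite_subringD[OF assms(1)]
  define S where "S = {q. Polynomial.degree q < Polynomial.degree g \<and> (\<forall>i. Polynomial.coeff q i \<in> R)}"
  have deg: "Polynomial.degree g > 0"
  proof (rule ccontr)
    assume "\<not> ?thesis"
    then obtain c where "g = [:c:]" using degree_eq_zeroE by blast
    then show False using g(1,3) by (auto split: if_splits)
  qed
  have "S \<subseteq> Poly ` {xs. set xs \<subseteq> R \<and> length xs = Polynomial.degree g}"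
  proof
    fix q assume q: "q \<in> S"
    let ?xs = "map (Polynomial.coeff q) [0..<Polynomial.degree g]"
    have "q = Poly ?xs"
      using q by (intro poly_eqI) (auto simp: nth_default_def S_def coeff_eq_0)
    moreover have "set ?xs \<subseteq> R" using q by (auto simp: S_def)
    ultimately show "q \<in> Poly ` {xs. set xs \<subseteq> R \<and> length xs = Polynomial.degree g}" by force
  qed
  then have finS: "finite S"
    using finite_lists_length_eq[OF R(1)] by (meson finite_imageI finite_subset)
  have "\<exists>q\<in>S. poly q u = u ^ n" for n
  proof (induction n)
    case 0
    have "1 \<in> S" using deg R by (auto simp: S_def coeff_1)
    then show ?case by (intro bexI[of _ 1]) auto
  next
    case (Suc n)
    then obtain q where q: "q \<in> S" "poly q u = u ^ n" by blast
    define c where "c = Polynomial.coeff (pCons 0 q) (Polynomial.degree g)"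
    define r where "r = pCons 0 q - Polynomial.smult c g"
    have coeffs: "Polynomial.coeff (pCons 0 q) i \<in> R" for i
      using q R by (auto simp: S_def coeff_pCons split: nat.split)
    have "Polynomial.coeff r i \<in> R" for i
      using coeffs R g by (auto simp: r_def c_def)
    moreover have "Polynomial.degree r < Polynomial.degree g"
    proof -
      have "Polynomial.degree (pCons 0 q) \<le> Polynomial.degree g"
        using q deg by (auto simp: S_def degree_pCons_eq_if)
      then have "Polynomial.degree r \<le> Polynomial.degree g"
        unfolding r_def by (intro degree_diff_le) (auto intro: order_trans[OF degree_smult_le])
      moreover have "Polynomial.coeff r (Polynomial.degree g) = 0" using g by (simp add: r_def c_def)
      ultimately show ?thesis
        using deg by (metis le_neq_implies_less leading_coeff_0_iff degree_0)
    qed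
    ultimately have "r \<in> S" by (auto simp: S_def)
    moreover have "poly r u = u ^ Suc n" using q g by (simp add: r_def)
    ultimately show ?case by blast
  qed
  then have "u ^ n \<in> (\<lambda>q. poly q u) ` S" for n by (metis imageI)
  then have "range (\<lambda>n. u ^ n) \<subseteq> (\<lambda>q. poly q u) ` S" by blast
  then show ?thesis using finS finite_subset by blast
qed

text \<open>
  The sums of multiples of powers of \<open>u\<close> form a ring, finite because the powers are.
\<close>
lemma finite_subring_adjoin:
  fixes T :: "'k::field set"
  assumes "finite_subring T" and u: "finite (range (\<lambda>n. u ^ n))"
  shows "\<exists>T'. finite_subring T' \<and> T \<subseteq> T' \<and> u \<in> T'"
proof -
  note T = finite_subringD[OF assms(1)]
  define P where "P = range (\<lambda>n. u ^ n)"
  have finP: "finite P" using u by (simp add: P_def)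
  define T' where "T' = (\<lambda>c. \<Sum>p\<in>P. c p * p) ` (P \<rightarrow>\<^sub>E T)"
  have T'I: "(\<Sum>p\<in>P. c p * p) \<in> T'" if "\<And>p. p \<in> P \<Longrightarrow> c p \<in> T" for c
    unfolding T'_def
    by (rule image_eqI[of _ _ "restrict c P"]) (use that in \<open>auto intro!: sum.cong\<close>)
  have T'E: "\<exists>c. (\<forall>p\<in>P. c p \<in> T) \<and> y = (\<Sum>p\<in>P. c p * p)" if "y \<in> T'" for y
    using that by (auto simp: T'_def)
  have fin: "finite T'" unfolding T'_def using finP T(1) by (auto intro: finite_PiE)
  have single: "t * p \<in> T'" if "t \<in> T" "p \<in> P" for t p
  proof -
    have "(\<Sum>q\<in>P. (if q = p then t else 0) * q) = (\<Sum>q\<in>P. if q = p then t * q else 0)"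
      by (rule sum.cong) auto
    then have "(\<Sum>q\<in>P. (if q = p then t else 0) * q) = t * p"
      using finP that by simp
    then show ?thesis using T'I[of "\<lambda>q. if q = p then t else 0"] that T by auto
  qed
  have P1: "1 \<in> P" unfolding P_def by (rule range_eqI[of _ _ 0]) simp
  have Pu: "u \<in> P" unfolding P_def by (rule range_eqI[of _ _ 1]) simp
  have PP: "p * q \<in> P" if "p \<in> P" "q \<in> P" for p q
    using that unfolding P_def by (auto simp flip: power_add)
  have T_T': "T \<subseteq> T'" using single[OF _ P1] by auto
  have u_T': "u \<in> T'" using single[OF T(3) Pu] by simp
  have diff: "y - z \<in> T'" if yz: "y \<in> T'" "z \<in> T'" for y z
  proof -
    obtain c d where cd: "\<forall>p\<in>P. c p \<in> T" "y = (\<Sum>p\<in>P. c p * p)" "\<forall>p\<in>P. d p \<in> T" "z = (\<Sum>p\<in>P. d p * p)"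
      using T'E yz by meson
    then have "y - z = (\<Sum>p\<in>P. (c p - d p) * p)" by (simp add: sum_subtractf left_diff_distrib)
    then show ?thesis using T'I[of "\<lambda>p. c p - d p"] cd T by auto
  qed
  have zero: "0 \<in> T'" using single[OF T(2) P1] by simp
  have add: "y + z \<in> T'" if "y \<in> T'" "z \<in> T'" for y z
    using diff[OF that(1) diff[OF zero that(2)]] by simp
  have sum: "(\<Sum>i\<in>I. w i) \<in> T'" if "\<And>i. i \<in> I \<Longrightarrow> w i \<in> T'" for w and I :: "'k set"
    using that by (induction I rule: infinite_finite_induct) (auto simp: zero add)
  have "y * z \<in> T'" if yz: "y \<in> T'" "z \<in> T'" for y z
  proof -
    obtain c d where cd: "\<forall>p\<in>P. c p \<in> T" "y = (\<Sum>p\<in>P. c p * p)" "\<forall>p\<in>P. d p \<in> T" "z = (\<Sum>p\<in>P. d p * p)"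
      using T'E yz by meson
    have "y * z = (\<Sum>p\<in>P. \<Sum>q\<in>P. (c p * d q) * (p * q))"
      unfolding cd sum_product by (intro sum.cong) (auto simp: ac_simps)
    also have "\<dots> \<in> T'"
      by (intro sum single) (use cd T PP in auto)
    finally show ?thesis .
  qed
  then show ?thesis
    using fin diff T_T' u_T' T(3) unfolding subring_set_def by blast
qed

text \<open>
  Adjoining the generators one after another to the prime ring gives a finite ring, which is closed under
  inverses.
\<close>
lemma locally_finite_if_finite_powers:
  assumes "CHAR('k::field) > 0" "\<And>u :: 'k::field. finite (range (\<lambda>n. u ^ n))"
  shows "locally_finite_field (ring_of_type_algebra :: 'k::field ring)"
  unfolding locally_finite_field_def
proof (intro allI impI, elim conjE)
  let ?K = "ring_of_type_algebra :: 'k ring"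
  fix S assume "finite (S :: 'k set)"
  then have "\<exists>T. finite_subring T \<and> S \<subseteq> T"
  proof (induction S rule: finite_induct)
    case empty
    then show ?case using finite_subring_range_of_int[OF assms(1)] by blast
  next
    case (insert u S)
    then obtain T where "finite_subring T" "S \<subseteq> T" by blast
    then show ?case using finite_subring_adjoin[OF _ assms(2)[of u], of T] by blast
  qed
  then obtain T where T: "finite_subring T" "S \<subseteq> T" by blast
  note T_closed = finite_subringD[OF T(1)]
  have K: "field ?K" by (rule field_from_type_algebra)
  interpret K: Ring.field ?K by (rule K)
  have sel: "\<one>\<^bsub>?K\<^esub> = 1" "\<zero>\<^bsub>?K\<^esub> = 0" "x \<oplus>\<^bsub>?K\<^esub> y = x + y" "x \<otimes>\<^bsub>?K\<^esub> y = x * y" "carrier ?K = UNIV" for x y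
    by (auto simp: ring_of_type_algebra_def)
  have neg: "\<ominus>\<^bsub>?K\<^esub> x = - x" for x
    using K.minus_equality[of "- x" x] by (simp add: sel)
  have inv: "inv\<^bsub>?K\<^esub> x = inverse x" if "x \<noteq> 0" for x
    using K.comm_inv_char[of x "inverse x"] that by (simp add: sel)
  have "generate_field ?K S \<subseteq> T"
  proof
    fix x assume "x \<in> generate_field ?K S"
    then show "x \<in> T"
    proof induction
      case (m_inv h)
      then show ?case
        using inverse_in_finite_subring[OF T(1), of h] inv by (auto simp: sel)
    qed (use T(2) T_closed in \<open>auto simp: sel neg\<close>)
  qed
  then show "finite (generate_field ?K S)" using T_closed(1) finite_subset by blast
qed

text \<open>
  In characteristic zero \<open>1/5\<close> is not an integer. In positive characteristic, if \<open>w f(u) = 1\<close> for an integral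
  polynomial \<open>f\<close>, then \<open>u\<close> is a root of the nonconstant polynomial \<open>(X\<^sup>3 - X - 1) f - 1\<close> over the prime field, and has
  finitely many powers. If this holds for all \<open>u\<close> the field is locally finite.
\<close>
lemma exists_nonunit_cubic_value:
  assumes "\<not> locally_finite_field (ring_of_type_algebra :: 'k::field ring)"
  obtains u :: "'k::field" where "u ^ 3 - u - 1 \<noteq> 0" "inverse (u ^ 3 - u - 1) \<notin> poly_values (range of_int) u"
proof (cases "CHAR('k) = 0")
  case True
  have inj: "z = w" if "of_int z = (of_int w :: 'k)" for z w
  proof -
    have "of_int (z - w) = (0::'k)" using that by simp
    then have "of_nat (nat \<bar>z - w\<bar>) = (0::'k)"
      unfolding of_nat_nat[OF abs_ge_zero] by (simp add: abs_if)
    then have "CHAR('k) dvd nat \<bar>z - w\<bar>" by (simp only: of_nat_eq_0_iff_char_dvd)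
    then have "nat \<bar>z - w\<bar> = 0" unfolding True by simp
    then show ?thesis by simp
  qed
  have "of_int 5 \<noteq> (of_int 0 :: 'k)" using inj[of 5 0] by auto
  then have five: "(2::'k) ^ 3 - 2 - 1 = 5" "(5::'k) \<noteq> 0" by auto
  have int_valued: "poly f 2 \<in> range of_int" if "\<forall>i. Polynomial.coeff f i \<in> range of_int" for f :: "'k poly"
    using that
  proof (induction f)
    case (pCons c f)
    have "c \<in> range of_int" using pCons(3) by (metis coeff_pCons_0)
    moreover have "\<forall>i. Polynomial.coeff f i \<in> range of_int" using pCons(3) by (metis coeff_pCons_Suc)
    moreover have "(2::'k) \<in> range of_int" by (metis of_int_numeral rangeI)
    ultimately show ?case using pCons.IH by (auto intro!: range_of_int_closed)
  qed (auto intro: range_eqI[of _ _ 0])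
  have not_int: "inverse 5 \<notin> range (of_int :: int \<Rightarrow> 'k)"
  proof
    assume "inverse 5 \<in> range (of_int :: int \<Rightarrow> 'k)"
    then obtain z where z: "inverse 5 = (of_int z :: 'k)" by auto
    have "5 * inverse 5 = (1::'k)" using five(2) by simp
    then have "of_int (5 * z) = (of_int 1 :: 'k)" unfolding z by simp
    then have "5 * z = 1" by (rule inj)
    then show False by presburger
  qed
  have "poly_values (range of_int) (2::'k) \<subseteq> range of_int"
    unfolding poly_values_def using int_valued by blast
  then have "inverse 5 \<notin> poly_values (range of_int) (2::'k)"
    using not_int by blast
  then show ?thesis using five by (intro that[of 2]) simp_all
next
  case False
  show ?thesis
  proof (rule ccontr)
    assume "\<not> thesis"
    then have all: "u ^ 3 - u - 1 = 0 \<or> inverse (u ^ 3 - u - 1) \<in> poly_values (range of_int) u" for u :: 'k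
      using that by blast
    let ?R = "range (of_int :: int \<Rightarrow> 'k)"
    have "finite_subring ?R" using finite_subring_range_of_int False by auto
    note R = this finite_subringD[OF this]
    define c where "c = [:-1, -1, 0, 1::'k:]"
    have c: "Polynomial.coeff c i \<in> ?R" for i
      using R(3,4) R(8)[OF R(4)] by (auto simp: c_def coeff_pCons split: nat.split)
    have deg_c: "Polynomial.degree c = 3" "Polynomial.lead_coeff c = 1" "poly c u = u ^ 3 - u - 1" for u
      by (auto simp: c_def power3_eq_cube algebra_simps)
    have "finite (range (\<lambda>n. u ^ n))" for u :: 'k
    proof (cases "u ^ 3 - u - 1 = 0")
      case True
      then have "poly c u = 0" by (simp only: deg_c)
      then show ?thesis by (rule finite_powers_of_monic_root[OF R(1) deg_c(2) c])
    next
      case nz: False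
      then have "inverse (u ^ 3 - u - 1) \<in> poly_values ?R u" using all[of u] by blast
      then obtain f where "\<forall>i. Polynomial.coeff f i \<in> ?R" "inverse (u ^ 3 - u - 1) = poly f u"
        unfolding poly_values_def by blast
      note f = this(1)[rule_format] this(2)[symmetric]
      have "f \<noteq> 0" using f nz by auto
      define g where "g = c * f - 1"
      have "Polynomial.degree (c * f) = 3 + Polynomial.degree f"
        using \<open>f \<noteq> 0\<close> deg_c by (subst degree_mult_eq) auto
      then have deg_g: "Polynomial.degree g = 3 + Polynomial.degree f"
        unfolding g_def using degree_add_eq_left[of "- 1" "c * f"] by simp
      then have "Polynomial.lead_coeff g = Polynomial.coeff (c * f) (Polynomial.degree (c * f))"
        using \<open>Polynomial.degree (c * f) = _\<close> by (simp add: g_def coeff_1)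
      then have lead: "Polynomial.lead_coeff g = Polynomial.lead_coeff f"
        by (simp only: lead_coeff_mult deg_c(2) mult_1_left)
      have g_R: "Polynomial.coeff g i \<in> ?R" for i
        unfolding g_def coeff_diff coeff_mult coeff_1
        by (intro R(5) R(7) R(9) c f) (use R(3,4) in auto)
      have inv: "inverse (Polynomial.lead_coeff f) \<in> ?R"
        by (rule inverse_in_finite_subring[OF R(1) f(1)])
      let ?g = "Polynomial.smult (inverse (Polynomial.lead_coeff f)) g"
      have g1: "Polynomial.lead_coeff ?g = 1" using lead \<open>f \<noteq> 0\<close> by simp
      have g2: "Polynomial.coeff ?g i \<in> ?R" for i
        unfolding coeff_smult by (intro range_of_int_closed inv g_R)
      have g3: "poly ?g u = 0" using f nz by (simp add: g_def deg_c)
      show ?thesis by (rule finite_powers_of_monic_root[OF R(1) g1 g2 g3])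
    qed
    then show False
      using assms locally_finite_if_finite_powers False by auto
  qed
qed

section \<open>Existence of valuation rings\<close>

text \<open>
  Chevalley's argument: a ring \<open>V\<close> that is maximal among those omitting \<open>1/w\<close> has the required property.
  If neither \<open>x\<close> nor \<open>1/x\<close> is in \<open>V\<close>, then \<open>1/w\<close> is a polynomial over \<open>V\<close> in each of them. By maximality every
  \<open>1 - wc\<close> is a unit of \<open>V\<close>, so the shorter relation expresses a power of \<open>x\<close> by lower ones and shortens the longer
  relation, a descent that cannot go on.
\<close>
lemma valuation_subring_exists:
  fixes w :: "'k::field"
  assumes A: "subring_set A" "w \<in> A" "inverse w \<notin> A"
  obtains V where "subring_set V" "A \<subseteq> V" "inverse w \<notin> V" "\<And>x. x \<in> V \<or> inverse x \<in> V"
proof -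
  define admissible where "admissible = {V. subring_set V \<and> A \<subseteq> V \<and> inverse w \<notin> V}"
  have "A \<in> admissible" using A by (auto simp: admissible_def)
  have "\<Union>K \<in> admissible" if K: "K \<noteq> {}" "subset.chain admissible K" for K
  proof -
    have sub: "\<And>U. U \<in> K \<Longrightarrow> subring_set U \<and> A \<subseteq> U \<and> inverse w \<notin> U"
      and tot: "\<And>U W. U \<in> K \<Longrightarrow> W \<in> K \<Longrightarrow> U \<subseteq> W \<or> W \<subseteq> U"
      using K by (auto simp: subset_chain_def admissible_def)
    have "subring_set (\<Union>K)"
      unfolding subring_set_def
    proof (intro conjI ballI)
      show "1 \<in> \<Union>K" using K(1) sub subring_setD(2) by blast
      fix y z assume "y \<in> \<Union>K" "z \<in> \<Union>K"
      then obtain U W where "U \<in> K" "W \<in> K" "y \<in> U" "z \<in> W" by blast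
      then obtain Z where Z: "Z \<in> K" "y \<in> Z" "z \<in> Z" using tot by blast
      then show "y - z \<in> \<Union>K" "y * z \<in> \<Union>K"
        using subring_setD(3,5)[of Z y z] sub by blast+
    qed
    then show ?thesis using K(1) sub unfolding admissible_def by blast
  qed
  from subset_Zorn_nonempty[OF _ this] obtain V where V: "V \<in> admissible"
    and max: "\<And>U. U \<in> admissible \<Longrightarrow> V \<subseteq> U \<Longrightarrow> U = V"
    using \<open>A \<in> admissible\<close> by (metis empty_iff)
  have V_sub: "subring_set V" and AV: "A \<subseteq> V" and wV: "inverse w \<notin> V"
    using V by (auto simp: admissible_def)
  note R = subring_setD[OF V_sub]
  have w: "w \<in> V" "w \<noteq> 0" using A AV R(1) wV by auto
  have eq1: "c \<notin> V" if "w * c = 1" for c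
    using that wV inverse_unique by blast
  have adjoin: "\<exists>f. (\<forall>i. Polynomial.coeff f i \<in> V) \<and> w * poly f x = 1" if "x \<notin> V" for x
  proof -
    have "poly_values V x \<notin> admissible"
      using max[of "poly_values V x"] subring_set_poly_values[OF V_sub, of x] that by blast
    then have "inverse w \<in> poly_values V x"
      using subring_set_poly_values[OF V_sub, of x] AV by (auto simp: admissible_def)
    then obtain f where "\<forall>i. Polynomial.coeff f i \<in> V" "poly f x = inverse w"
      by (auto simp: poly_values_def)
    then show ?thesis using w by (intro exI[of _ f]) auto
  qed
  \<comment> \<open>Clearing denominators in a relation over \<open>V\<close> with the inverse of \<open>1 - wc\<close> yields one over \<open>V\<close>,
    because powers of \<open>1 - wc\<close> are congruent to \<open>1\<close> modulo \<open>w\<close>.\<close>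
  have unit: "inverse (1 - w * c) \<in> V" if c: "c \<in> V" for c
  proof (rule ccontr)
    define y where "y = 1 - w * c"
    assume "inverse (1 - w * c) \<notin> V"
    then obtain f where f: "\<forall>i. Polynomial.coeff f i \<in> V" "w * poly f (inverse y) = 1"
      using adjoin y_def by blast
    have y: "y \<in> V" unfolding y_def using R w c by auto
    have y0: "y \<noteq> 0" using eq1[of c] c by (auto simp: y_def)
    define n where "n = Polynomial.degree f"
    define s where "s = (\<Sum>i\<le>n. Polynomial.coeff f i * y ^ (n - i))"
    have "s \<in> V" unfolding s_def using f R y by (auto intro!: R(8) R(5))
    have "y ^ n * poly f (inverse y) = s"
      unfolding poly_altdef s_def n_def sum_distrib_left
    proof (rule sum.cong)
      fix i assume "i \<in> {..Polynomial.degree f}"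
      then have "y ^ Polynomial.degree f = y ^ (Polynomial.degree f - i) * y ^ i"
        by (simp flip: power_add)
      then show "y ^ Polynomial.degree f * (Polynomial.coeff f i * inverse y ^ i) =
          Polynomial.coeff f i * y ^ (Polynomial.degree f - i)"
        using y0 by (simp add: power_inverse)
    qed simp
    then have "w * s = y ^ n" using f(2) by (metis mult.left_commute mult_1_right)
    moreover have "\<exists>d\<in>V. y ^ n = 1 - w * d"
    proof (induction n)
      case 0 show ?case using R by (intro bexI[of _ 0]) auto
    next
      case (Suc n)
      then obtain d where d: "d \<in> V" "y ^ n = 1 - w * d" by blast
      have "y ^ Suc n = (1 - w * c) * (1 - w * d)" using d(2) by (simp add: y_def)
      also have "\<dots> = 1 - w * (c + d - w * c * d)" by (simp add: algebra_simps)
      finally show ?case using d c w R by (intro bexI[of _ "c + d - w * c * d"]) auto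
    qed
    ultimately obtain d where "d \<in> V" "w * s = 1 - w * d" by metis
    then have "w * (s + d) = 1" "s + d \<in> V" using R \<open>s \<in> V\<close> by (auto simp: algebra_simps)
    then show False using eq1 by blast
  qed
  define P where "P x n \<longleftrightarrow>
    (\<exists>f. (\<forall>i. Polynomial.coeff f i \<in> V) \<and> Polynomial.degree f = n \<and> w * poly f x = 1)" for x n
  have P0: "\<not> P x 0" for x
  proof
    assume "P x 0"
    then obtain f where f: "\<forall>i. Polynomial.coeff f i \<in> V" "Polynomial.degree f = 0" "w * poly f x = 1"
      by (auto simp: P_def)
    then obtain c where "f = [:c:]" using degree_eq_zeroE by blast
    then have "c \<in> V" "w * c = 1" using f(1)[rule_format, of 0] f(3) by auto
    then show False using eq1 by blast
  qed
  have reduce: "\<exists>n'<n. P x n'" if prem: "P x n" "P (inverse x) m" "m \<le> n" "x \<noteq> 0" for x n m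
  proof -
    obtain f where f: "\<forall>i. Polynomial.coeff f i \<in> V" "Polynomial.degree f = n" "w * poly f x = 1"
      using prem unfolding P_def by blast
    obtain g where g: "\<forall>i. Polynomial.coeff g i \<in> V" "Polynomial.degree g = m" "w * poly g (inverse x) = 1"
      using prem unfolding P_def by blast
    have n0: "0 < n" using prem(1) P0 by (cases n) auto
    have m0: "0 < m" using prem(2) P0 by (cases m) auto
    define c where "c = Polynomial.coeff g 0"
    define v where "v = inverse (1 - w * c)"
    have v: "v \<in> V" "v * (1 - w * c) = 1"
    proof -
      show "v \<in> V" unfolding v_def using unit g(1) c_def by blast
      have "1 - w * c \<noteq> 0" using eq1[of c] g(1) by (auto simp: c_def)
      then show "v * (1 - w * c) = 1" by (simp add: v_def)
    qed
    \<comment> \<open>The relation for \<open>1/x\<close>, divided by the unit \<open>1 - wc\<close> and multiplied by \<open>x\<^sup>n\<close>, reads \<open>x\<^sup>n = h(x)\<close>.\<close>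
    define h where "h = (\<Sum>i<m. Polynomial.monom (v * w * Polynomial.coeff g (Suc i)) (n - Suc i))"
    have h_V: "Polynomial.coeff h i \<in> V" for i
      unfolding h_def coeff_sum using g v w R by (intro R(8)) (auto simp: coeff_monom)
    have h_deg: "Polynomial.degree h < n"
    proof -
      have "Polynomial.degree h \<le> n - 1"
        unfolding h_def by (intro degree_sum_le) (auto intro: order_trans[OF degree_monom_le])
      then show ?thesis using n0 by simp
    qed
    have "{..m} = insert 0 (Suc ` {..<m})" using m0
      by (auto simp: image_iff) (metis Suc_le_eq lessThan_iff not0_implies_Suc)
    then have "poly g (inverse x) = c + (\<Sum>i<m. Polynomial.coeff g (Suc i) * inverse x ^ Suc i)"
      unfolding poly_altdef g(2) by (simp add: sum.reindex c_def)
    then have "w * (\<Sum>i<m. Polynomial.coeff g (Suc i) * inverse x ^ Suc i) = 1 - w * c"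
      using g(3) by (simp add: algebra_simps)
    then have one: "v * (w * (\<Sum>i<m. Polynomial.coeff g (Suc i) * inverse x ^ Suc i)) = 1"
      using v(2) by simp
    have "poly h x = (\<Sum>i<m. v * w * Polynomial.coeff g (Suc i) * x ^ (n - Suc i))"
      unfolding h_def by (simp add: poly_sum poly_monom)
    also have "\<dots> = (\<Sum>i<m. x ^ n * (v * w * Polynomial.coeff g (Suc i) * inverse x ^ Suc i))"
    proof (rule sum.cong)
      fix i assume "i \<in> {..<m}"
      then have "n = (n - Suc i) + Suc i" using prem(3) by simp
      then have "x ^ n = x ^ (n - Suc i) * x ^ Suc i" by (metis power_add)
      then show "v * w * Polynomial.coeff g (Suc i) * x ^ (n - Suc i)
          = x ^ n * (v * w * Polynomial.coeff g (Suc i) * inverse x ^ Suc i)"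
        using prem(4) by (simp add: power_inverse del: power_Suc)
    qed simp
    also have "\<dots> = x ^ n * (v * (w * (\<Sum>i<m. Polynomial.coeff g (Suc i) * inverse x ^ Suc i)))"
      by (simp add: sum_distrib_left mult.assoc)
    finally have h_x: "poly h x = x ^ n" unfolding one by simp
    define a where "a = Polynomial.coeff f n"
    define f' where "f' = f - Polynomial.monom a n + Polynomial.smult a h"
    have "\<forall>i. Polynomial.coeff f' i \<in> V"
      unfolding f'_def a_def using f h_V R by (auto simp: coeff_monom)
    moreover have "w * poly f' x = 1"
      using f(3) by (simp add: f'_def poly_monom h_x)
    moreover have "Polynomial.degree f' < n"
    proof -
      have "Polynomial.coeff f' i = 0" if "n - 1 < i" for i
        using that f(2) h_deg n0
        by (cases "i = n") (auto simp: f'_def a_def coeff_monom coeff_eq_0)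
      then have "Polynomial.degree f' \<le> n - 1" by (intro degree_le) auto
      then show ?thesis using n0 by simp
    qed
    ultimately show ?thesis unfolding P_def by blast
  qed
  have no_both: "\<not> (P x n \<and> P (inverse x) m)" if "x \<noteq> 0" for x n m
    using that
  proof (induction "n + m" arbitrary: x n m rule: less_induct)
    case less
    show ?case
    proof
      assume *: "P x n \<and> P (inverse x) m"
      show False
      proof (cases "m \<le> n")
        case True
        then obtain n' where "n' < n" "P x n'" using reduce * less.prems by blast
        then show False using less.hyps[of n' m x] * less.prems by auto
      next
        case False
        have "\<exists>m'<m. P (inverse x) m'"
          using reduce[of "inverse x" m n] * less.prems False by auto
        then obtain m' where "m' < m" "P (inverse x) m'" by blast
        then show False using less.hyps[of n m' x] * less.prems by auto
      qed
    qed
  qed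
  have "x \<in> V \<or> inverse x \<in> V" for x
  proof (cases "x = 0")
    case True then show ?thesis using R by auto
  next
    case False
    then show ?thesis
      using no_both[OF False] adjoin[of x] adjoin[of "inverse x"] unfolding P_def by blast
  qed
  then show thesis using that V_sub AV wV by blast
qed

section \<open>Four axes in a plane over a valuation ring\<close>

text \<open>
  In terms of the valuation, \<open>|q| \<le> |w| max(1, |p|)\<close>: the point \<open>(p, q)\<close> is close to the first axis, and
  the map \<open>(p, q) \<mapsto> (wp, q/w)\<close> does not enlarge it.
\<close>
definition near_axis :: "'k::field set \<Rightarrow> 'k \<Rightarrow> 'k \<Rightarrow> 'k \<Rightarrow> bool" where
  "near_axis V w p q \<longleftrightarrow> (\<exists>c\<in>V. q = c * w \<or> q = c * (w * p))"

lemma near_axis_cover: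
  assumes V: "\<And>x. x \<in> V \<or> inverse x \<in> V" and "w \<noteq> 0"
  shows "near_axis V w (p / w) (w * q) \<or> near_axis V w q p"
proof (cases "q \<in> V")
  case True
  then show ?thesis unfolding near_axis_def by (metis mult.commute)
next
  case q: False
  show ?thesis
  proof (cases "w * q / p \<in> V \<and> p \<noteq> 0")
    case True
    then have "w * q = (w * q / p) * (w * (p / w))" using assms(2) by (simp add: field_simps)
    then show ?thesis using True unfolding near_axis_def by blast
  next
    case False
    then have "p = 0 \<or> p / (w * q) \<in> V" using V[of "w * q / p"] by auto
    moreover have "q \<noteq> 0" "0 \<in> V" using q V[of 0] by auto
    ultimately have "p / (w * q) \<in> V" "p = p / (w * q) * (w * q)" using assms(2) by auto
    then show ?thesis unfolding near_axis_def by blast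
  qed
qed

lemma near_axis_level:
  assumes "p \<in> V"
  shows "near_axis V w (q / w) (w * p)"
  unfolding near_axis_def by (rule bexI[OF _ assms(1)]) (simp add: mult.commute)

locale ping_pong_valuation =
  fixes V :: "'k::field set" and u w :: 'k
  assumes subring: "subring_set V" and valuation: "\<And>x. x \<in> V \<or> inverse x \<in> V"
    and u: "u \<in> V" and w_def: "w = u ^ 3 - u - 1" and w: "w \<noteq> 0" "inverse w \<notin> V"
begin

lemmas V = subring_setD[OF subring]

lemma w_V: "w \<in> V"
  unfolding w_def by (intro V u)

text \<open>
  The coordinates in which the generators are diagonal. The second pair of axes is given by the linear forms
  \<open>x - y\<close> and \<open>x - uy\<close>; the constants \<open>1\<close> and \<open>u\<^sup>2\<close> are chosen so that no three of the four axes meet.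
\<close>
definition coord :: "bool \<Rightarrow> 'k \<times> 'k \<Rightarrow> 'k \<times> 'k" where
  "coord i = (\<lambda>(x, y). if i then (x, y) else (x - y - 1, x - u * y - u\<^sup>2))"

definition near :: "bool \<Rightarrow> bool \<Rightarrow> 'k \<times> 'k \<Rightarrow> bool" where
  "near i e z = (let (p, q) = coord i z in if e then near_axis V w p q else near_axis V w q p)"

text \<open>
  Let \<open>\<rho>\<close> be the larger of the two coordinates, outside \<open>V\<close> if the claim fails. Being near an axis
  makes one of the four affine forms strictly smaller than \<open>\<rho>\<close>. The constants are smaller as well, and any two of
  the forms determine both coordinates up to units, so both would be smaller than \<open>\<rho>\<close>.
\<close>
lemma two_near_imp_integral:
  assumes "near i e (x, y)" "near j d (x, y)" "(i, e) \<noteq> (j, d)"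
  shows "x \<in> V \<and> y \<in> V"
proof (rule ccontr)
  assume not_int: "\<not> ?thesis"
  define le where "le a b \<longleftrightarrow> (\<exists>c\<in>V. a = c * b)" for a b
  have le_total: "le a b \<or> le b a" for a b
  proof (cases "b = 0 \<or> a = 0")
    case True then show ?thesis using V(1) by (auto simp: le_def)
  next
    case False
    have "a = a / b * b" "b = b / a * a" "inverse (a / b) = b / a" using False by auto
    then show ?thesis using valuation[of "a / b"] unfolding le_def by metis
  qed
  have le_refl: "le a a" for a using V(2) by (auto simp: le_def)
  have le_trans: "le a c" if "le a b" "le b c" for a b c
    using that V(5) unfolding le_def by (metis mult.assoc)
  have le_mult: "le (c * a) b" if "c \<in> V" "le a b" for a b c
    using that V(5) unfolding le_def by (metis mult.assoc)
  have le_diff: "le (a - a') b" if "le a b" "le a' b" for a a' b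
    using that V(3) unfolding le_def by (metis left_diff_distrib)
  obtain \<rho> where \<rho>: "\<rho> \<in> {x, y}" "le x \<rho>" "le y \<rho>" "\<rho> \<notin> V"
  proof (cases "le x y")
    case True
    moreover have "y \<notin> V" using not_int True V(5) by (auto simp: le_def)
    ultimately show ?thesis using that le_refl by blast
  next
    case False
    then have "le y x" using le_total by blast
    moreover have "x \<notin> V" using not_int \<open>le y x\<close> V(5) by (auto simp: le_def)
    ultimately show ?thesis using that le_refl by blast
  qed
  have \<rho>0: "\<rho> \<noteq> 0" using \<rho>(4) V(1) by blast
  define I where "I = {a. le a \<rho> \<and> \<not> le \<rho> a}"
  have I_mult: "c * a \<in> I" if "c \<in> V" "a \<in> I" for a c
    using that le_mult le_trans le_refl unfolding I_def by blast
  have I_diff: "a - b \<in> I" if "a \<in> I" "b \<in> I" for a b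
  proof -
    have "le (a - b) a \<or> le (a - b) b"
      using le_total[of a b] le_diff le_refl by blast
    then show ?thesis using that le_diff le_trans unfolding I_def by blast
  qed
  have I_V: "c \<in> I" if "c \<in> V" for c
  proof -
    have "inverse \<rho> \<in> V" using valuation \<rho>(4) by blast
    then have "c * inverse \<rho> \<in> V" using V that by blast
    moreover have "c = c * inverse \<rho> * \<rho>" using \<rho>0 by simp
    ultimately have "le c \<rho>" unfolding le_def by metis
    moreover have "\<not> le \<rho> c" using \<rho>(4) that V(5) by (auto simp: le_def)
    ultimately show ?thesis by (simp add: I_def)
  qed
  have I_add: "a + b \<in> I" if "a \<in> I" "b \<in> I" for a b
    using I_diff[OF that(1) I_diff[OF I_V[OF V(1)] that(2)]] by simp
  have I_w: "w * a \<in> I" if a: "le a \<rho>" for a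
  proof -
    have "le (w * a) \<rho>" using le_mult w_V a by blast
    moreover have "\<not> le \<rho> (w * a)"
    proof
      assume "le \<rho> (w * a)"
      moreover obtain c where c: "c \<in> V" "a = c * \<rho>" using a by (auto simp: le_def)
      ultimately obtain d where d: "d \<in> V" "\<rho> = d * (w * (c * \<rho>))" by (auto simp: le_def)
      then have "\<rho> * 1 = \<rho> * (w * (d * c))" by (simp add: algebra_simps)
      then have "w * (d * c) = 1" using \<rho>0 by simp
      then have "inverse w = d * c" using inverse_unique by blast
      then show False using w(2) V(5) c(1) d(1) by simp
    qed
    ultimately show ?thesis by (simp add: I_def)
  qed
  have near_I: "q \<in> I" if near: "near_axis V w p q" and p: "le p \<rho>" for p q
  proof -
    obtain c where c: "c \<in> V" "q = c * w \<or> q = c * (w * p)" using near by (auto simp: near_axis_def)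
    have "w \<in> I" using I_V w_V by blast
    then show ?thesis using c I_mult I_w[OF p] by blast
  qed
  have le_V: "le c \<rho>" if "c \<in> V" for c using I_V[OF that] by (simp add: I_def)
  define p q where "p = x - y - 1" and "q = x - u * y - u\<^sup>2"
  have p_le: "le p \<rho>" and q_le: "le q \<rho>"
    unfolding p_def q_def by (intro le_diff le_mult \<rho> u le_V V)+
  have key: "(if i then if e then y else x else if e then q else p) \<in> I"
    if "near i e (x, y)" for i e
    using that near_I \<rho>(2,3) p_le q_le by (auto simp: near_def coord_def p_def q_def split: if_splits)
  have xy_notin: "\<not> (x \<in> I \<and> y \<in> I)"
    using \<rho>(1) le_refl by (auto simp: I_def)
  have uI: "1 \<in> I" "u\<^sup>2 \<in> I" using I_V V u by auto
  \<comment> \<open>\<open>u\<^sup>3 - u = 1 + w\<close> acts as a unit on sizes, so factors of it can be cancelled.\<close>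
  have cubic: "z \<in> I" if z: "(u ^ 3 - u) * z \<in> I" "le z \<rho>" for z
  proof -
    have "z = (u ^ 3 - u) * z - w * z" by (simp add: w_def algebra_simps)
    then show ?thesis using I_diff[OF z(1) I_w[OF z(2)]] by simp
  qed
  have y_of_uy: "y \<in> I" if "u * y \<in> I"
  proof (rule cubic)
    have eq: "(u ^ 3 - u) * y = (u\<^sup>2 - 1) * (u * y)" by (simp add: algebra_simps power2_eq_square power3_eq_cube)
    show "(u ^ 3 - u) * y \<in> I" unfolding eq by (rule I_mult[OF _ that]) (intro V u)
  qed (rule \<rho>)
  have y_of_uy': "y \<in> I" if "(u - 1) * y \<in> I"
  proof (rule cubic)
    have eq: "(u ^ 3 - u) * y = (u\<^sup>2 + u) * ((u - 1) * y)" by (simp add: algebra_simps power2_eq_square power3_eq_cube)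
    show "(u ^ 3 - u) * y \<in> I" unfolding eq by (rule I_mult[OF _ that]) (intro V u)
  qed (rule \<rho>)
  have yq: False if "y \<in> I" "q \<in> I"
  proof -
    have "x = q + u * y + u\<^sup>2" by (simp add: q_def)
    then have "x \<in> I" using that uI I_add I_mult[OF u] by metis
    then show False using that xy_notin by blast
  qed
  have yp: False if "y \<in> I" "p \<in> I"
  proof -
    have "x = p + y + 1" by (simp add: p_def)
    then have "x \<in> I" using that uI I_add by metis
    then show False using that xy_notin by blast
  qed
  have xq: False if "x \<in> I" "q \<in> I"
  proof -
    have "u * y = x - q - u\<^sup>2" by (simp add: q_def)
    then have "y \<in> I" using y_of_uy that uI I_diff by metis
    then show False using that xy_notin by blast
  qed
  have xp: False if "x \<in> I" "p \<in> I"
  proof -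
    have "y = x - p - 1" by (simp add: p_def)
    then have "y \<in> I" using that uI I_diff by metis
    then show False using that xy_notin by blast
  qed
  have pq: False if "p \<in> I" "q \<in> I"
  proof -
    have "(u - 1) * y = p - q + 1 - u\<^sup>2" by (simp add: p_def q_def algebra_simps)
    then have "y \<in> I" using y_of_uy' that uI I_diff I_add by metis
    then show False using that yp by blast
  qed
  show False
    using key[OF assms(1)] key[OF assms(2)] assms(3) yq yp xq xp pq xy_notin
    by (cases i; cases e; cases j; cases d; simp; blast)
qed

text \<open>
  For integral points nearness means that an affine form vanishes modulo \<open>w\<close>. If three vanish, so does a
  divisor of a power of \<open>1 + w = u (u - 1) (u + 1)\<close>, which is impossible modulo \<open>w\<close>.
\<close>
lemma not_three_near:
  assumes "near i e z" "near j d z" "near k c z"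
  shows "(i, e) = (j, d) \<or> (i, e) = (k, c) \<or> (j, d) = (k, c)"
proof (rule ccontr)
  assume distinct: "\<not> ?thesis"
  obtain x y where z: "z = (x, y)" by (cases z)
  have int: "x \<in> V" "y \<in> V"
    using two_near_imp_integral[of i e x y j d] assms distinct unfolding z by blast+
  define J where "J = {c * w |c. c \<in> V}"
  have J_mult: "a * b \<in> J" if "a \<in> V" "b \<in> J" for a b
    using that V(5) unfolding J_def by (auto simp flip: mult.assoc)
  have J_diff: "a - b \<in> J" if "a \<in> J" "b \<in> J" for a b
    using that V(3) unfolding J_def by (auto simp flip: left_diff_distrib)
  have J_w: "w \<in> J" unfolding J_def by (rule CollectI, rule exI[of _ 1]) (use V in auto)
  have J_1: "1 \<notin> J"
  proof
    assume "1 \<in> J"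
    then obtain c where "c \<in> V" "w * c = 1" unfolding J_def by (auto simp: mult.commute)
    then show False using w(2) inverse_unique by blast
  qed
  have near_J: "q \<in> J" if near: "near_axis V w p q" and p: "p \<in> V" for p q
  proof -
    obtain c where c: "c \<in> V" "q = c * w \<or> q = c * p * w" using near by (auto simp: near_axis_def ac_simps)
    then show ?thesis unfolding J_def using V(5)[OF c(1) p] by blast
  qed
  define p q where "p = x - y - 1" and "q = x - u * y - u\<^sup>2"
  have pV: "p \<in> V" and qV: "q \<in> V"
    unfolding p_def q_def by (intro int V u)+
  have key: "(if i then if e then y else x else if e then q else p) \<in> J"
    if "near i e (x, y)" for i e
    using that near_J int pV qV by (auto simp: near_def coord_def p_def q_def split: if_splits)
  have J_unit: "z \<notin> J" if "t * z = (1 + w) ^ n" "t \<in> V" for z t n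
  proof
    assume "z \<in> J"
    have "1 - (1 + w) ^ n \<in> J"
    proof (induction n)
      case 0 show ?case using J_diff[OF J_w J_w] by simp
    next
      case (Suc n)
      have "1 - (1 + w) ^ Suc n = (1 - (1 + w) ^ n) - (1 + w) ^ n * w" by (simp add: algebra_simps)
      then show ?case using J_diff[OF Suc J_mult[OF V(7) J_w]] w_V V by metis
    qed
    moreover have "(1 + w) ^ n \<in> J" using J_mult[OF that(2) \<open>z \<in> J\<close>] that(1) by simp
    moreover have "1 = (1 - (1 + w) ^ n) - (0 - (1 + w) ^ n)" by simp
    ultimately show False using J_1 J_diff[OF J_w J_w] J_diff by (metis cancel_comm_monoid_add_class.diff_cancel)
  qed
  have w1: "1 + w = u ^ 3 - u" by (simp add: w_def)
  have xyp: False if "x \<in> J" "y \<in> J" "p \<in> J"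
  proof -
    have "x - y - p = 1" by (simp add: p_def)
    then show False using J_1 J_diff that by metis
  qed
  have xyq: False if "x \<in> J" "y \<in> J" "q \<in> J"
  proof -
    have "x - u * y - q = u\<^sup>2" by (simp add: q_def)
    then have "u\<^sup>2 \<in> J" using J_diff J_mult[OF u] that by metis
    moreover have "(u\<^sup>2 - 1)\<^sup>2 \<in> V" by (intro V u)
    moreover have "(u\<^sup>2 - 1)\<^sup>2 * u\<^sup>2 = (1 + w) ^ 2"
      unfolding w1 by (simp add: algebra_simps power2_eq_square power3_eq_cube)
    ultimately show False using J_unit[of "(u\<^sup>2 - 1)\<^sup>2" "u\<^sup>2" 2] by blast
  qed
  have ypq: False if "y \<in> J" "p \<in> J" "q \<in> J"
  proof -
    have "p - q - (u - 1) * y = u\<^sup>2 - 1" by (simp add: p_def q_def algebra_simps)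
    then have "u\<^sup>2 - 1 \<in> J" using J_diff J_mult[OF V(3)[OF u V(2)]] that by metis
    moreover have "u * (u\<^sup>2 - 1) = (1 + w) ^ 1"
      unfolding w1 by (simp add: algebra_simps power2_eq_square power3_eq_cube)
    ultimately show False using J_unit[of u "u\<^sup>2 - 1" 1] u by blast
  qed
  have xpq: False if "x \<in> J" "p \<in> J" "q \<in> J"
  proof -
    have "(x - q) - u * (x - p) = u\<^sup>2 - u" by (simp add: p_def q_def algebra_simps)
    then have "u\<^sup>2 - u \<in> J" using J_diff J_mult[OF u] that by metis
    moreover have "u + 1 \<in> V" by (intro V u)
    moreover have "(u + 1) * (u\<^sup>2 - u) = (1 + w) ^ 1"
      unfolding w1 by (simp add: algebra_simps power2_eq_square power3_eq_cube)
    ultimately show False using J_unit[of "u + 1" "u\<^sup>2 - u" 1] by blast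
  qed
  show False
    using key[OF assms(1)[unfolded z]] key[OF assms(2)[unfolded z]] key[OF assms(3)[unfolded z]]
      distinct xyp xyq ypq xpq
    by (cases i; cases e; cases j; cases d; cases k; cases c; simp; blast)
qed

lemma near_cover:
  assumes "coord i z = (p, q)" "coord i z' = (p / w, w * q)"
  shows "near i True z' \<or> near i False z"
  using near_axis_cover[of V w p q] valuation w(1) assms by (simp add: near_def)

lemma near_level:
  assumes z: "fst z \<in> V" "snd z \<in> V" and pq: "coord i z = (p, q)"
  shows "coord i z' = (w * p, q / w) \<Longrightarrow> near i False z'"
    and "coord i z' = (p / w, w * q) \<Longrightarrow> near i True z'"
proof -
  have "fst (coord i z) \<in> V \<and> snd (coord i z) \<in> V"
    using z V u by (cases z; cases i) (auto simp: coord_def intro!: V)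
  then have "p \<in> V" "q \<in> V" using pq by auto
  then show "coord i z' = (w * p, q / w) \<Longrightarrow> near i False z'"
    and "coord i z' = (p / w, w * q) \<Longrightarrow> near i True z'"
    using near_axis_level[of p V w q] near_axis_level[of q V w p] by (simp_all add: near_def)
qed

end

section \<open>The paradoxical decomposition\<close>

definition plane_map :: "('k::field ^ 'n \<Rightarrow> 'k) \<Rightarrow> ('k ^ 'n \<Rightarrow> 'k) \<Rightarrow> 'k ^ 'n \<Rightarrow> 'k ^ 'n \<Rightarrow> 'k \<Rightarrow> 'k \<Rightarrow>
    'k \<Rightarrow> 'k \<Rightarrow> 'k ^ 'n \<Rightarrow> 'k ^ 'n" where
  "plane_map \<phi> \<psi> e f c d \<alpha> \<beta> x = x + ((\<alpha> - 1) * (\<phi> x - c)) *s e + ((\<beta> - 1) * (\<psi> x - d)) *s f"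

lemma plane_map_coordinates:
  assumes lin: "\<And>x y. \<phi> (x + y) = \<phi> x + \<phi> y" "\<And>c x. \<phi> (c *s x) = c * \<phi> x"
      "\<And>x y. \<psi> (x + y) = \<psi> x + \<psi> y" "\<And>c x. \<psi> (c *s x) = c * \<psi> x"
    and dual: "\<phi> e = 1" "\<phi> f = 0" "\<psi> e = 0" "\<psi> f = 1"
  shows "\<phi> (plane_map \<phi> \<psi> e f c d \<alpha> \<beta> x) - c = \<alpha> * (\<phi> x - c)"
    and "\<psi> (plane_map \<phi> \<psi> e f c d \<alpha> \<beta> x) - d = \<beta> * (\<psi> x - d)"
    and "\<alpha> * \<alpha>' = 1 \<Longrightarrow> \<beta> * \<beta>' = 1 \<Longrightarrow>
      plane_map \<phi> \<psi> e f c d \<alpha> \<beta> (plane_map \<phi> \<psi> e f c d \<alpha>' \<beta>' x) = x"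
proof -
  show coord: "\<phi> (plane_map \<phi> \<psi> e f c d \<alpha> \<beta> x) - c = \<alpha> * (\<phi> x - c)"
    "\<psi> (plane_map \<phi> \<psi> e f c d \<alpha> \<beta> x) - d = \<beta> * (\<psi> x - d)" for \<alpha> \<beta>
    unfolding plane_map_def lin dual by (simp_all add: algebra_simps)
  assume inv: "\<alpha> * \<alpha>' = 1" "\<beta> * \<beta>' = 1"
  have "plane_map \<phi> \<psi> e f c d \<alpha> \<beta> (plane_map \<phi> \<psi> e f c d \<alpha>' \<beta>' x) =
      plane_map \<phi> \<psi> e f c d \<alpha>' \<beta>' x + ((\<alpha> - 1) * (\<alpha>' * (\<phi> x - c))) *s e
        + ((\<beta> - 1) * (\<beta>' * (\<psi> x - d))) *s f"
    unfolding plane_map_def[of _ _ _ _ _ _ \<alpha>] coord ..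
  also have "\<dots> = x + ((\<alpha> * \<alpha>' - 1) * (\<phi> x - c)) *s e + ((\<beta> * \<beta>' - 1) * (\<psi> x - d)) *s f"
    unfolding plane_map_def by (simp add: vec.scale_left_diff_distrib left_diff_distrib mult.assoc)
  also have "\<dots> = x" unfolding inv by simp
  finally show "plane_map \<phi> \<psi> e f c d \<alpha> \<beta> (plane_map \<phi> \<psi> e f c d \<alpha>' \<beta>' x) = x" .
qed

text \<open>
  The pieces are preimages, under \<open>x \<mapsto> (\<phi> x, \<psi> x)\<close>, of subsets of the plane in the orientation argument; the
  second generator is diagonal with respect to the dual pair \<open>(e', f')\<close> of \<open>\<phi> - \<psi>\<close> and \<open>\<phi> - u \<psi>\<close>.
\<close>
lemma paradoxical_if_equal_norm_plane:
  fixes v :: "'k::field \<Rightarrow> real" and N :: "'k ^ 'n \<Rightarrow> real"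
  assumes K: "trivial_valuation v" "nonarch_norm v N"
    and not_lf: "\<not> locally_finite_field (ring_of_type_algebra :: 'k ring)"
    and lin: "\<And>x y. \<phi> (x + y) = \<phi> x + \<phi> y" "\<And>c x. \<phi> (c *s x) = c * \<phi> x"
      "\<And>x y. \<psi> (x + y) = \<psi> x + \<psi> y" "\<And>c x. \<psi> (c *s x) = c * \<psi> x"
    and dual: "\<phi> e = 1" "\<phi> f = 0" "\<psi> e = 0" "\<psi> f = 1"
    and e: "N e \<le> r" "N f \<le> r" and r: "\<And>x. \<phi> x \<noteq> 0 \<or> \<psi> x \<noteq> 0 \<Longrightarrow> r \<le> N x"
  shows "paradoxical_using (affine_isometry_group N) UNIV (\<lambda>f. f) UNIV 4"
proof -
  interpret trivially_valued_norm v N by standard (use K in auto)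
  obtain u :: 'k where u: "u ^ 3 - u - 1 \<noteq> 0" "inverse (u ^ 3 - u - 1) \<notin> poly_values (range of_int) u"
    using exists_nonunit_cubic_value[OF not_lf] by blast
  define w where "w = u ^ 3 - u - 1"
  have int: "subring_set (range of_int :: 'k set)"
    unfolding subring_set_def
    by (intro conjI ballI range_of_int_closed) (auto intro: range_eqI[of _ _ 1])
  note A = subring_set_poly_values[OF int, of u]
  have "w \<in> poly_values (range of_int) u"
    unfolding w_def by (intro subring_setD[OF A(1)] A(3))
  then obtain V where V: "subring_set V" "poly_values (range of_int) u \<subseteq> V" "inverse w \<notin> V"
      "\<And>x. x \<in> V \<or> inverse x \<in> V"
    using valuation_subring_exists[OF A(1), of w] u(2) unfolding w_def by metis
  interpret ping_pong_valuation V u w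
    by standard (use V A(3) u(1) in \<open>auto simp: w_def\<close>)
  have "u \<noteq> 1"
  proof
    assume "u = 1"
    then have "inverse w = - 1" by (simp add: w_def)
    then show False using w(2) V(2,6) by metis
  qed
  define \<kappa> where "\<kappa> = inverse (u - 1)"
  have "\<kappa> * (u - 1) = 1" using \<open>u \<noteq> 1\<close> by (simp add: \<kappa>_def)
  then have \<kappa>: "\<kappa> * u = 1 + \<kappa>" by (simp add: algebra_simps)
  define \<phi>' where "\<phi>' x = \<phi> x - \<psi> x" for x
  define \<psi>' where "\<psi>' x = \<phi> x - u * \<psi> x" for x
  define e' where "e' = \<kappa> *s (u *s e + f)"
  define f' where "f' = (- \<kappa>) *s (e + f)"
  have lin': "\<And>x y. \<phi>' (x + y) = \<phi>' x + \<phi>' y" "\<And>c x. \<phi>' (c *s x) = c * \<phi>' x"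
      "\<And>x y. \<psi>' (x + y) = \<psi>' x + \<psi>' y" "\<And>c x. \<psi>' (c *s x) = c * \<psi>' x"
    unfolding \<phi>'_def \<psi>'_def lin by (simp_all add: algebra_simps)
  have dual': "\<phi>' e' = 1" "\<phi>' f' = 0" "\<psi>' e' = 0" "\<psi>' f' = 1"
    unfolding \<phi>'_def \<psi>'_def e'_def f'_def lin dual
    by (simp_all add: \<kappa> mult.commute[of u])
  have e'_le: "N e' \<le> r" "N f' \<le> r"
    unfolding e'_def f'_def
    by (intro order_trans[OF N_scale_le] N_add_leI e)+
  have r': "r \<le> N x" if "\<phi>' x \<noteq> 0 \<or> \<psi>' x \<noteq> 0" for x
    by (rule r) (use that in \<open>auto simp: \<phi>'_def \<psi>'_def\<close>)
  define F where "F i = (if i then plane_map \<phi> \<psi> e f 0 0 else plane_map \<phi>' \<psi>' e' f' 1 (u\<^sup>2))" for i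
  define z where "z x = (\<phi> x, \<psi> x)" for x
  have coord_z: "coord True (z x) = (\<phi> x - 0, \<psi> x - 0)" "coord False (z x) = (\<phi>' x - 1, \<psi>' x - u\<^sup>2)" for x
    by (simp_all add: z_def coord_def \<phi>'_def \<psi>'_def)
  have "coord True (z (F True \<alpha> \<beta> x)) = (\<alpha> * fst (coord True (z x)), \<beta> * snd (coord True (z x)))"
    "coord False (z (F False \<alpha> \<beta> x)) = (\<alpha> * fst (coord False (z x)), \<beta> * snd (coord False (z x)))"
    for \<alpha> \<beta> x
    unfolding F_def if_True if_False coord_z fst_conv snd_conv
      plane_map_coordinates(1,2)[OF lin dual] plane_map_coordinates(1,2)[OF lin' dual'] by simp_all
  then have coord_F: "coord i (z (F i \<alpha> \<beta> x)) = (\<alpha> * fst (coord i (z x)), \<beta> * snd (coord i (z x)))"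
    for i \<alpha> \<beta> x
    by (cases i) simp_all
  have F_inverse: "F i \<alpha> \<beta> (F i \<alpha>' \<beta>' x) = x" if "\<alpha> * \<alpha>' = 1" "\<beta> * \<beta>' = 1" for i \<alpha> \<beta> \<alpha>' \<beta>' x
    using plane_map_coordinates(3)[OF lin dual that] plane_map_coordinates(3)[OF lin' dual' that]
    by (simp add: F_def)
  have F_iso: "affine_isometry N (F i \<alpha> \<beta>)" if "\<alpha> \<noteq> 0" "\<beta> \<noteq> 0" for i \<alpha> \<beta>
    using affine_isometry_two_plane[OF lin dual e r that, of 0 0]
      affine_isometry_two_plane[OF lin' dual' e'_le r' that, of 1 "u\<^sup>2"]
    by (simp add: F_def plane_map_def[abs_def])
  have w0: "w \<noteq> 0" by (rule w(1))
  show ?thesis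
  proof (rule paradoxical_using_four_of_half_edges[where f = "\<lambda>i. F i (1 / w) w" and
        g = "\<lambda>i. F i w (1 / w)" and Q = "\<lambda>i e. {x. near i e (z x)}"])
    show "id \<in> carrier (affine_isometry_group N)"
      by (simp add: affine_isometry_group_def affine_isometry_id)
    show "F i (1 / w) w \<in> carrier (affine_isometry_group N)" for i
      using F_iso[of "1 / w" w i] w0 by (simp add: affine_isometry_group_def)
    show "F i (1 / w) w (F i w (1 / w) x) = x" for i x
      by (rule F_inverse) (use w0 in simp_all)
    show "F i w (1 / w) (F i (1 / w) w x) = x" for i x
      by (rule F_inverse) (use w0 in simp_all)
    show "F i (1 / w) w x \<in> {x. near i True (z x)} \<or> x \<in> {x. near i False (z x)}" for i x
      using near_cover[of i "z x" "fst (coord i (z x))" "snd (coord i (z x))"]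
      by (simp add: coord_F)
    show "(i, e) = (j, d) \<or> (i, e) = (k, c) \<or> (j, d) = (k, c)"
      if "x \<in> {x. near i e (z x)}" "x \<in> {x. near j d (z x)}" "x \<in> {x. near k c (z x)}"
      for x i e j d k c
      using that not_three_near by blast
    show "(if e then F i w (1 / w) x else F i (1 / w) w x) \<in> {x. near i (\<not> e) (z x)}"
      if x: "x \<in> {x. near i e (z x)}" "x \<in> {x. near j d (z x)}" and ij: "(i, e) \<noteq> (j, d)"
      for x i e j d
    proof -
      have "\<phi> x \<in> V \<and> \<psi> x \<in> V"
        by (rule two_near_imp_integral[OF _ _ ij]) (use x in \<open>auto simp: z_def\<close>)
      then have "fst (z x) \<in> V" "snd (z x) \<in> V" by (simp_all add: z_def)
      note level = near_level[OF this, of i "fst (coord i (z x))" "snd (coord i (z x))"]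
      show ?thesis
        using level(1)[of "z (F i w (1 / w) x)"] level(2)[of "z (F i (1 / w) w x)"]
        by (simp add: coord_F)
    qed
  qed
qed

theorem theorem3p13:
  fixes v :: "'k::field \<Rightarrow> real" and N :: "'k ^ 'n \<Rightarrow> real"
  assumes "trivial_valuation v"
    and "\<not> locally_finite_field (ring_of_type_algebra :: 'k ring)"
    and "CARD('n) \<ge> 2"
    and "nonarch_norm v N"
  shows "if finite (range N - {0}) \<and> card (range N - {0}) < CARD('n)
         then paradoxical_using (affine_isometry_group N) UNIV (\<lambda>f. f) UNIV 4
         else \<not> paradoxical (affine_isometry_group N) UNIV (\<lambda>f. f) UNIV"
proof -
  interpret trivially_valued_norm v N by standard (use assms in auto)
  show ?thesis
  proof (cases "finite (range N - {0}) \<and> card (range N - {0}) < CARD('n)")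
    case True
    obtain e f \<phi> \<psi> r where
      "\<And>x y. \<phi> (x + y) = \<phi> x + \<phi> y" "\<And>c x. \<phi> (c *s x) = c * \<phi> x"
      "\<And>x y. \<psi> (x + y) = \<psi> x + \<psi> y" "\<And>c x. \<psi> (c *s x) = c * \<psi> x"
      "\<phi> e = 1" "\<phi> f = 0" "\<psi> e = 0" "\<psi> f = 1"
      "N e \<le> r" "N f \<le> r" "\<And>x. \<phi> x \<noteq> 0 \<or> \<psi> x \<noteq> 0 \<Longrightarrow> r \<le> N x"
      by (rule exists_equal_norm_plane[OF conjunct1[OF True] conjunct2[OF True]]) (rule that)
    from paradoxical_if_equal_norm_plane[OF assms(1,4,2) this] show ?thesis unfolding if_P[OF True] .
  next
    case False
    from not_paradoxical_if_many_norms[OF False] show ?thesis unfolding if_not_P[OF False] .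
  qed
qed

end
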